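(* Let $\mathbf{R}$ be an ordered field, let $\mathfrak{N}$ be a non-trivial linearly ordered abelian group and let $\mathbb{T}=\mathbf{R}[[\mathfrak{N}]]$. Suppose that $(\mathbb{T},\log)$ is an exponentially closed transserial field, that $\partial$ is a flat transserial derivation on $\mathbb{T}$ with identity $x$, and that $(\mathbb{T},\partial)$ is an H-field. Let $\circ:\mathbb{T}\times\mathbb{T}^{>,\succ}\to\mathbb{T}$ be a flat transserial composition law with identity $x$, and assume that $(\partial,\circ)$ satisfies the chain rule and that $(\mathbb{T},\partial,\circ)$ has Taylor expansions. Let $\mathfrak{M}\subseteq\mathfrak{N}$ be a subgroup containing $x$ such that $\mathbb{S}=\mathbf{R}[[\mathfrak{M}]]$ is a differential subfield of $\mathbb{T}$ (i.e. $\partial(\mathbb{S})\subseteq\mathbb{S}$) and such that $\mathfrak{m}\circ(x+\delta)\in\mathbb{S}$ whenever $\mathfrak{m}\in\mathfrak{M}$ and $\delta\in\mathbb{S}$ with $\delta\prec x$. Then the class $\mathcal{G}:=\{x+\delta : \delta\in\mathbb{S},\ \delta\prec x\}$ is a group under the composition $\circ$.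
   Context: Well-based series. The set theory is NBG; groups and fields may be proper classes. For an ordered field $\mathbf{R}$ and a linearly ordered abelian group $(\mathfrak{M},\cdot,1,\prec)$, $\mathbf{R}[[\mathfrak{M}]]$ is the ordered field of functions $s:\mathfrak{M}\to\mathbf{R}$ whose support $\operatorname{supp}s=\{\mathfrak{m}:s(\mathfrak{m})\neq0\}$ is a set that is well-ordered for the reverse order $\succ$, with pointwise sum and Cauchy product; $s>0$ iff $s\neq0$ and $s(\max\operatorname{supp}s)>0$. Elements of $\mathfrak{M}$ (monomials) and of $\mathbf{R}$ are identified with series. For $s\neq0$, $\mathfrak{d}(s)=\max\operatorname{supp}s$. Write $s\prec t$ if $r|s|<|t|$ for all $r\in\mathbf{R}^{>}$; $s\preccurlyeq t$ if not $t\prec s$. For $\mathbb{S}=\mathbf{R}[[\mathfrak{M}]]$ put $\mathbb{S}_{\succ}=\{s:\operatorname{supp}s\succ1\}$ and $\mathbb{S}^{>,\succ}=\{s:s>\mathbf{R}\}$. A family $(s_i)_{i\in I}$ is summable if $\bigcup_i\operatorname{supp}s_i$ is a set well-ordered by $\succ$ and each monomial lies in finitely many $\operatorname{supp}s_i$; its sum is taken coefficientwise. An $\mathbf{R}$-linear map $\Phi$ is strongly linear if it maps summable families to summable families and commutes with their sums. Transserial fields. Let $\mathbb{T}=\mathbf{R}[[\mathfrak{N}]]$ and let $\log:(\mathbb{T}^{>},\cdot,1,<)\to(\mathbb{T},+,0,<)$ be an embedding of ordered groups. $(\mathbb{T},\log)$ is a transserial field if $\log\mathfrak{N}\subseteq\mathbb{T}_{\succ}$;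 $\log s\leqslant s-1$ for all $s\in\mathbb{T}^{>}$; $\log(1+\varepsilon)=\sum_{k>0}\frac{(-1)^{k+1}}{k}\varepsilon^k$ for all $\varepsilon\prec1$; and $\log$ restricts to an isomorphism of ordered groups $(\mathbf{R}^{>},\cdot)\to(\mathbf{R},+)$. It is exponentially closed if $\log:\mathbb{T}^{>}\to\mathbb{T}$ is surjective. For $s,t\in\mathbb{T}^{\times}$ write $s\prec\!\!\prec t$ if $\log|s|\prec\log|t|$, and $s\preccurlyeq\!\!\preccurlyeq t$ if $\log|s|\preccurlyeq\log|t|$. Derivations. A transserial derivation on $\mathbb{T}$ is a strongly linear $\partial:\mathbb{T}\to\mathbb{T}$ satisfying the Leibniz rule and $\partial(\log|s|)=\partial(s)/s$ for $s\neq0$; write $f'=\partial(f)$ and $f^{(k)}=\partial^k(f)$. An identity of $\partial$ is an $x\in\mathbb{T}^{>}$ with $1\notin\operatorname{supp}x$ and $\partial(x)=1$. $(\mathbb{T},\partial)$ is an H-field if $\ker\partial=\mathbf{R}$ and $f'>0$ for all $f\in\mathbb{T}^{>,\succ}$. In that case $\partial$ (with identity $x$) is flat if for all $\mathfrak{m}\in\mathfrak{N}$ and $\mathfrak{n}\in\operatorname{supp}\partial(\mathfrak{m})$ there are $\mathfrak{f},\mathfrak{w}\in\mathfrak{N}$ with $\mathfrak{f}\prec\!\!\prec\mathfrak{m}$, $\mathfrak{w}\preccurlyeq\!\!\preccurlyeq x$ and $\mathfrak{n}=\mathfrak{m}\mathfrak{f}\mathfrak{w}$. Composition laws. A transserial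 composition law on $\mathbb{T}$ is a map $\circ:\mathbb{T}\times\mathbb{T}^{>,\succ}\to\mathbb{T}$ such that for each $s\in\mathbb{T}^{>,\succ}$ the map $f\mapsto f\circ s$ is a strongly linear morphism of ordered rings commuting with $\log$, and $f\circ(s\circ t)=(f\circ s)\circ t$ for all $f\in\mathbb{T}$, $s,t\in\mathbb{T}^{>,\succ}$. Its identity is an $x\in\mathbb{T}^{>,\succ}$ with $x\circ s=s$ and $f\circ x=f$ for all such $s,f$. It is flat if for all $s\in\mathbb{T}^{>,\succ}$, $\mathfrak{m}\in\mathfrak{N}\setminus\{1\}$ and $\mathfrak{n}\in\operatorname{supp}(\mathfrak{m}\circ s)$ there are $\mathfrak{f},\mathfrak{w}\in\mathfrak{N}$ and $\mathfrak{u}\in\operatorname{supp}s$ with $\mathfrak{f}\prec\!\!\prec\mathfrak{m}$, $\mathfrak{w}\preccurlyeq1$, $\mathfrak{w}\preccurlyeq\!\!\preccurlyeq\mathfrak{u}$ and $\mathfrak{n}=\mathfrak{d}(\mathfrak{m}\circ s)\mathfrak{f}\mathfrak{w}$. $(\partial,\circ)$ satisfies the chain rule if $(f\circ s)'=s'\cdot(f'\circ s)$ for all $f\in\mathbb{T}$, $s\in\mathbb{T}^{>,\succ}$. A series $f$ is in Taylor configuration at $(s,\delta)$ ($s\in\mathbb{T}^{>,\succ}$, $\delta\in\mathbb{T}$) if $\delta\prec s$ and $(\mathfrak{m}'\circ s)\delta\prec\mathfrak{m}\circ s$ for all $\mathfrak{m}\in\operatorname{supp}f$. $(\mathbb{T},\partial,\circ)$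 has Taylor expansions if whenever $f$ is in Taylor configuration at $(s,\delta)$, the family $((\mathfrak{m}^{(k)}\circ s)\delta^k)_{\mathfrak{m}\in\operatorname{supp}f,\,k\in\mathbb{N}}$ is summable, $f\circ(s+\delta)=\sum_{k}\frac{f^{(k)}\circ s}{k!}\delta^k=\sum_{\mathfrak{m}\in\operatorname{supp} f,\,k}f(\mathfrak{m})\frac{\mathfrak{m}^{(k)}\circ s}{k!}\delta^k$, and $(f^{(k)}\circ s)\delta^k\succ(f^{(k+1)}\circ s)\delta^{k+1}$ for every $k$ with $(f^{(k)}\circ s)\delta^k\neq0$. *)

theory Defs
  imports "HOL-Algebra.Group"
begin

unbundle cardinal_syntax

text \<open>
  Groups and fields may be proper classes in NBG, whereas supports of series and unions of
  supports of summable families are sets. Here classes are types (and sets over types), and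
  the sets among them are those of cardinality less than \<open>\<kappa> = |UNIV :: 'k set|\<close>, for an arbitrary
  uncountable regular \<open>\<kappa>\<close>; in a universe of NBG, \<open>\<kappa>\<close> is the class of all ordinals.
  The bound cannot be dropped: the field of all well-based series over a nontrivial group
  whose underlying class is a set is never exponentially closed (Kuhlmann, Kuhlmann and Shelah).
\<close>

class regular_uncountable =
  assumes regularCard_UNIV: "regularCard |UNIV :: 'a set|"
    and uncountable_UNIV: "natLeq <o |UNIV :: 'a set|"

definition small :: "'k itself \<Rightarrow> 'a set \<Rightarrow> bool"
  where "small _ A \<longleftrightarrow> |A| <o |UNIV :: 'k set|"

definition well_based :: "'n::linorder set \<Rightarrow> bool"
  where "well_based A \<longleftrightarrow> wfp_on A (>)"

lemma small_empty: "small TYPE('k) {}"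
  unfolding small_def by (metis card_of_empty3 card_of_Well_order not_ordLeq_iff_ordLess UNIV_not_empty)

lemma infinite_regular: "infinite (UNIV :: 'k::regular_uncountable set)"
  using uncountable_UNIV[where 'a='k]
  by (metis finite_iff_ordLess_natLeq ordLess_irreflexive ordLess_transitive)

lemma small_finite: "finite A \<Longrightarrow> small TYPE('k::regular_uncountable) A"
  unfolding small_def
  by (meson card_of_Well_order card_of_ordLeq_infinite infinite_regular not_ordLess_iff_ordLeq)

lemma small_subset: "A \<subseteq> B \<Longrightarrow> small TYPE('k) B \<Longrightarrow> small TYPE('k) A"
  unfolding small_def by (meson card_of_mono1 ordLeq_ordLess_trans)

lemma small_image: "small TYPE('k) A \<Longrightarrow> small TYPE('k) (f ` A)"
  unfolding small_def by (meson card_of_image ordLeq_ordLess_trans)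

lemma small_Un: "small TYPE('k::regular_uncountable) A \<Longrightarrow> small TYPE('k) B \<Longrightarrow> small TYPE('k) (A \<union> B)"
  unfolding small_def by (rule card_of_Un_ordLess_infinite[OF infinite_regular])

lemma small_Times:
  assumes "small TYPE('k::regular_uncountable) A" "small TYPE('k) B"
  shows "small TYPE('k) (A \<times> B)"
proof (cases "finite A \<and> finite B")
  case True
  then show ?thesis by (simp add: small_finite)
next
  case False
  define f where "f = Inl ` A \<union> Inr ` B"
  have f: "small TYPE('k) f" unfolding f_def by (intro small_Un small_image assms)
  have "infinite f" unfolding f_def using False by (auto simp: finite_image_iff)
  then have "|f \<times> f| =o |f|" by (rule card_of_Times_same_infinite)
  then have "small TYPE('k) (f \<times> f)" using f unfolding small_def by (rule ordIso_ordLess_trans)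
  then have "small TYPE('k) (map_prod projl projr ` (f \<times> f))" by (rule small_image)
  moreover have "A \<times> B \<subseteq> map_prod projl projr ` (f \<times> f)"
  proof clarify
    fix a b assume "a \<in> A" "b \<in> B"
    then have "(Inl a, Inr b) \<in> f \<times> f" by (auto simp: f_def)
    then show "(a, b) \<in> map_prod projl projr ` (f \<times> f)" by (force intro: image_eqI[rotated])
  qed
  ultimately show ?thesis by (meson small_subset)
qed

lemma well_based_alt:
  "well_based A \<longleftrightarrow> (\<forall>B. B \<subseteq> A \<longrightarrow> B \<noteq> {} \<longrightarrow> (\<exists>m\<in>B. \<forall>n\<in>B. n \<le> m))"
  unfolding well_based_def wfp_on_iff_ex_minimal by (metis linorder_not_le)

lemma well_based_empty: "well_based {}"
  by (auto simp: well_based_alt)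

lemma well_based_subset: "A \<subseteq> B \<Longrightarrow> well_based B \<Longrightarrow> well_based A"
  by (auto simp: well_based_alt)

lemma well_based_finite: "finite A \<Longrightarrow> well_based A"
  by (metis well_based_alt Max_ge Max_in finite_subset)

lemma well_based_Un:
  assumes "well_based A" "well_based B" shows "well_based (A \<union> B)"
  unfolding well_based_alt
proof (intro allI impI)
  fix C assume C: "C \<subseteq> A \<union> B" "C \<noteq> {}"
  show "\<exists>m\<in>C. \<forall>n\<in>C. n \<le> m"
  proof (cases "C \<inter> A = {} \<or> C \<inter> B = {}")
    case True
    then have "C \<subseteq> A \<or> C \<subseteq> B" using C by auto
    then show ?thesis using assms C unfolding well_based_alt by blast
  next
    case False
    obtain a where a: "a \<in> C \<inter> A" "\<forall>n\<in>C \<inter> A. n \<le> a"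
      using False assms(1) unfolding well_based_alt by (meson inf_le2)
    obtain b where b: "b \<in> C \<inter> B" "\<forall>n\<in>C \<inter> B. n \<le> b"
      using False assms(2) unfolding well_based_alt by (meson inf_le2)
    have "max a b \<in> C" using a b by (auto simp: max_def)
    moreover have "\<forall>n\<in>C. n \<le> max a b" using a b C by (auto simp: le_max_iff_disj)
    ultimately show ?thesis by blast
  qed
qed

lemma finite_two_sided:
  fixes C :: "'n::linorder set"
  assumes mx: "\<And>B. B \<subseteq> C \<Longrightarrow> B \<noteq> {} \<Longrightarrow> \<exists>m\<in>B. \<forall>n\<in>B. n \<le> m"
    and mn: "\<And>B. B \<subseteq> C \<Longrightarrow> B \<noteq> {} \<Longrightarrow> \<exists>m\<in>B. \<forall>n\<in>B. m \<le> n"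
  shows "finite C"
proof (rule ccontr)
  assume inf: "infinite C"
  let ?Q = "{c\<in>C. infinite {d\<in>C. c \<le> d}}"
  obtain m where m: "m \<in> C" "\<forall>n\<in>C. m \<le> n" using mn[of C] inf by auto
  have "{d\<in>C. m \<le> d} = C" using m by auto
  then have "m \<in> ?Q" using m inf by simp
  then obtain c where c: "c \<in> ?Q" "\<forall>n\<in>?Q. n \<le> c" using mx[of ?Q] by blast
  let ?D = "{d\<in>C. c < d}"
  have "{d\<in>C. c \<le> d} \<subseteq> insert c ?D" by auto
  then have infD: "infinite ?D" using c(1) finite_subset[OF _ finite.insertI[of ?D c]] by blast
  then obtain d where d: "d \<in> ?D" "\<forall>n\<in>?D. d \<le> n" using mn[of ?D] by fastforce
  have "?D \<subseteq> {e\<in>C. d \<le> e}" using d by auto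
  then have "d \<in> ?Q" using d infD finite_subset by auto
  then show False using c d by auto
qed

lemma finite_decomp:
  fixes m :: "'n::linordered_ab_group_add"
  assumes A: "well_based A" and B: "well_based B"
  shows "finite {a\<in>A. m - a \<in> B}"
proof (rule finite_two_sided)
  fix D assume D: "D \<subseteq> {a\<in>A. m - a \<in> B}" "D \<noteq> {}"
  have DA: "D \<subseteq> A" using D by auto
  then show "\<exists>x\<in>D. \<forall>n\<in>D. n \<le> x" using A D(2) unfolding well_based_alt by blast
  have "(\<lambda>a. m - a) ` D \<subseteq> B" "(\<lambda>a. m - a) ` D \<noteq> {}" using D by auto
  then obtain y where "y \<in> (\<lambda>a. m - a) ` D" "\<forall>n\<in>(\<lambda>a. m - a) ` D. n \<le> y"
    using B unfolding well_based_alt by blast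
  then obtain x where "x \<in> D" "\<forall>n\<in>D. m - n \<le> m - x" by auto
  then show "\<exists>x\<in>D. \<forall>n\<in>D. x \<le> n" by (intro bexI[of _ x]) auto
qed

lemma well_based_plus:
  fixes A :: "'n::linordered_ab_group_add set"
  assumes A: "well_based A" and B: "well_based B"
  shows "well_based ((\<lambda>(a, b). a + b) ` (A \<times> B))"
  unfolding well_based_alt
proof (intro allI impI, rule ccontr)
  fix C assume C: "C \<subseteq> (\<lambda>(a, b). a + b) ` (A \<times> B)" "C \<noteq> {}"
    and no: "\<not> (\<exists>m\<in>C. \<forall>n\<in>C. n \<le> m)"
  text \<open>Choose, above each element of \<open>C\<close>, the largest first component; the second
    components of these pairs cannot increase forever.\<close>
  have ex: "\<exists>c'\<in>C. c \<le> c' \<and> (\<exists>a\<in>A. c' - a \<in> B \<and> (\<forall>c''\<in>C. \<forall>a'\<in>A. c \<le> c'' \<longrightarrow> c'' - a' \<in> B \<longrightarrow> a' \<le> a))"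
    if c: "c \<in> C" for c
  proof -
    let ?E = "{a\<in>A. \<exists>c'\<in>C. c \<le> c' \<and> c' - a \<in> B}"
    have "?E \<noteq> {}" using C c by fastforce
    then obtain a where "a \<in> ?E" "\<forall>n\<in>?E. n \<le> a" using A unfolding well_based_alt by (metis (no_types, lifting) mem_Collect_eq subsetI)
    then show ?thesis by blast
  qed
  define good where "good c a \<longleftrightarrow> c \<in> C \<and> a \<in> A \<and> c - a \<in> B \<and> (\<forall>c'\<in>C. \<forall>a'\<in>A. c \<le> c' \<longrightarrow> c' - a' \<in> B \<longrightarrow> a' \<le> a)" for c a
  have good: "\<exists>c' a. c \<le> c' \<and> good c' a" if "c \<in> C" for c
    using ex[OF that] unfolding good_def by (meson order_trans)
  let ?F = "{b. \<exists>c a. good c a \<and> b = c - a}"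
  have "?F \<subseteq> B" unfolding good_def by auto
  moreover have "?F \<noteq> {}" using C good by blast
  ultimately obtain b where b: "b \<in> ?F" "\<forall>n\<in>?F. n \<le> b" using B unfolding well_based_alt by meson
  then obtain c a where ca: "good c a" "b = c - a" by blast
  then have "c \<in> C" by (simp add: good_def)
  then obtain d where d: "d \<in> C" "c < d" using no by (meson linorder_not_le)
  obtain e a' where e: "d \<le> e" "good e a'" using good[OF d(1)] by blast
  have "c \<le> e" using d e by auto
  then have "a' \<le> a" using ca(1) e(2) unfolding good_def by blast
  moreover have "e - a' \<le> c - a" using b(2)[rule_format, of "e - a'"] e(2) ca(2) by blast
  ultimately have "e \<le> c" using add_mono by fastforce
  then show False using d e by auto
qed

text \<open>
  The monomial group is written additively, as required by \<^class>\<open>linordered_ab_group_add\<close>: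
  \<open>m + n\<close>, \<open>0\<close> and \<open>m < n\<close> stand for the product, the monomial 1 and \<open>m \<prec> n\<close>.
\<close>

typedef (overloaded) ('r::zero, 'n::linorder, 'k) series =
  "{s :: 'n \<Rightarrow> 'r. well_based {m. s m \<noteq> 0} \<and> small TYPE('k) {m. s m \<noteq> 0}}"
  morphisms coeff Series
  by (rule exI[of _ "\<lambda>_. 0"]) (simp add: well_based_empty small_empty)

setup_lifting type_definition_series

definition supp :: "('r::zero, 'n::linorder, 'k) series \<Rightarrow> 'n set"
  where "supp s = {m. coeff s m \<noteq> 0}"

lemma series_eqI: "(\<And>m. coeff s m = coeff t m) \<Longrightarrow> s = t"
  by (metis coeff_inject ext)

lemma well_based_supp: "well_based (supp s)" and small_supp: "small TYPE('k) (supp (s :: (_, _, 'k) series))"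
  using coeff[of s] by (auto simp: supp_def)

instantiation series :: (linordered_field, linordered_ab_group_add, regular_uncountable) comm_ring_1
begin

lift_definition zero_series :: "('a, 'b, 'c) series" is "\<lambda>_. 0"
  by (simp add: well_based_empty small_empty)

lift_definition one_series :: "('a, 'b, 'c) series" is "\<lambda>m. if m = 0 then 1 else 0"
  by (simp add: well_based_finite small_finite)

lift_definition plus_series :: "('a, 'b, 'c) series \<Rightarrow> ('a, 'b, 'c) series \<Rightarrow> ('a, 'b, 'c) series"
  is "\<lambda>s t m. s m + t m"
proof -
  fix s t :: "'b \<Rightarrow> 'a"
  assume s: "well_based {m. s m \<noteq> 0} \<and> small TYPE('c) {m. s m \<noteq> 0}"
    and t: "well_based {m. t m \<noteq> 0} \<and> small TYPE('c) {m. t m \<noteq> 0}"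
  have "{m. s m + t m \<noteq> 0} \<subseteq> {m. s m \<noteq> 0} \<union> {m. t m \<noteq> 0}" by auto
  then show "well_based {m. s m + t m \<noteq> 0} \<and> small TYPE('c) {m. s m + t m \<noteq> 0}"
    using s t by (meson well_based_subset well_based_Un small_subset small_Un)
qed

lift_definition uminus_series :: "('a, 'b, 'c) series \<Rightarrow> ('a, 'b, 'c) series"
  is "\<lambda>s m. - s m"
  by simp

lift_definition minus_series :: "('a, 'b, 'c) series \<Rightarrow> ('a, 'b, 'c) series \<Rightarrow> ('a, 'b, 'c) series"
  is "\<lambda>s t m. s m - t m"
proof -
  fix s t :: "'b \<Rightarrow> 'a"
  assume s: "well_based {m. s m \<noteq> 0} \<and> small TYPE('c) {m. s m \<noteq> 0}"
    and t: "well_based {m. t m \<noteq> 0} \<and> small TYPE('c) {m. t m \<noteq> 0}"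
  have "{m. s m - t m \<noteq> 0} \<subseteq> {m. s m \<noteq> 0} \<union> {m. t m \<noteq> 0}" by auto
  then show "well_based {m. s m - t m \<noteq> 0} \<and> small TYPE('c) {m. s m - t m \<noteq> 0}"
    using s t by (meson well_based_subset well_based_Un small_subset small_Un)
qed

lift_definition times_series :: "('a, 'b, 'c) series \<Rightarrow> ('a, 'b, 'c) series \<Rightarrow> ('a, 'b, 'c) series"
  is "\<lambda>s t m. \<Sum>a | s a \<noteq> 0 \<and> t (m - a) \<noteq> 0. s a * t (m - a)"
proof -
  fix s t :: "'b \<Rightarrow> 'a"
  assume s: "well_based {m. s m \<noteq> 0} \<and> small TYPE('c) {m. s m \<noteq> 0}"
    and t: "well_based {m. t m \<noteq> 0} \<and> small TYPE('c) {m. t m \<noteq> 0}"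
  let ?st = "\<lambda>m. \<Sum>a | s a \<noteq> 0 \<and> t (m - a) \<noteq> 0. s a * t (m - a)"
  let ?P = "(\<lambda>(a, b). a + b) ` ({m. s m \<noteq> 0} \<times> {m. t m \<noteq> 0})"
  have "{m. ?st m \<noteq> 0} \<subseteq> ?P"
  proof
    fix m assume "m \<in> {m. ?st m \<noteq> 0}"
    then obtain a where "s a \<noteq> 0" "t (m - a) \<noteq> 0"
      by (auto elim!: sum.not_neutral_contains_not_neutral)
    then have "(a, m - a) \<in> {m. s m \<noteq> 0} \<times> {m. t m \<noteq> 0}" "m = a + (m - a)" by auto
    then show "m \<in> ?P" by (intro image_eqI[of _ _ "(a, m - a)"]) auto
  qed
  moreover have "well_based ?P" using s t by (simp add: well_based_plus)
  moreover have "small TYPE('c) ?P" using s t by (simp add: small_image small_Times)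
  ultimately show "well_based {m. ?st m \<noteq> 0} \<and> small TYPE('c) {m. ?st m \<noteq> 0}"
    by (meson well_based_subset small_subset)
qed

lemma coeff_times:
  fixes s t :: "('a, 'b, 'c) series"
  assumes A: "supp s \<subseteq> A" "well_based A" and B: "supp t \<subseteq> B" "well_based B"
  shows "coeff (s * t) m = (\<Sum>a | a \<in> A \<and> m - a \<in> B. coeff s a * coeff t (m - a))"
  unfolding times_series.rep_eq
  by (rule sum.mono_neutral_left) (use A B finite_decomp[OF A(2) B(2)] in \<open>auto simp: supp_def\<close>)

lemma supp_times:
  fixes s t :: "('a, 'b, 'c) series"
  shows "supp (s * t) \<subseteq> (\<lambda>(a, b). a + b) ` (supp s \<times> supp t)"
proof
  fix m assume "m \<in> supp (s * t)"
  then obtain a where "coeff s a \<noteq> 0" "coeff t (m - a) \<noteq> 0"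
    unfolding supp_def times_series.rep_eq
    by (auto elim!: sum.not_neutral_contains_not_neutral)
  then have "(a, m - a) \<in> supp s \<times> supp t" "m = a + (m - a)" by (auto simp: supp_def)
  then show "m \<in> (\<lambda>(a, b). a + b) ` (supp s \<times> supp t)"
    by (intro image_eqI[of _ _ "(a, m - a)"]) auto
qed

lemma times_comm_series:
  fixes s t :: "('a, 'b, 'c) series"
  shows "s * t = t * s"
proof (rule series_eqI)
  fix m
  show "coeff (s * t) m = coeff (t * s) m"
    unfolding times_series.rep_eq
    by (rule sum.reindex_bij_witness[of _ "\<lambda>a. m - a" "\<lambda>a. m - a"]) (auto simp: mult.commute)
qed

lemma times_assoc_series:
  fixes s t u :: "('a, 'b, 'c) series"
  shows "(s * t) * u = s * (t * u)"
proof (rule series_eqI)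
  fix m
  let ?A = "supp s" and ?B = "supp t" and ?C = "supp u"
  let ?AB = "(\<lambda>(a, b). a + b) ` (?A \<times> ?B)" and ?BC = "(\<lambda>(a, b). a + b) ` (?B \<times> ?C)"
  note wb = well_based_supp[of s] well_based_supp[of t] well_based_supp[of u]
  have AB: "well_based ?AB" and BC: "well_based ?BC" using wb by (auto intro: well_based_plus)
  have "coeff ((s * t) * u) m = (\<Sum>p | p \<in> ?AB \<and> m - p \<in> ?C. coeff (s * t) p * coeff u (m - p))"
    by (rule coeff_times[OF supp_times AB order_refl wb(3)])
  also have "\<dots> = (\<Sum>p | p \<in> ?AB \<and> m - p \<in> ?C. \<Sum>a | a \<in> ?A \<and> p - a \<in> ?B. coeff s a * coeff t (p - a) * coeff u (m - p))"
    by (subst coeff_times[OF order_refl wb(1) order_refl wb(2)]) (simp add: sum_distrib_right)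
  also have "\<dots> = (\<Sum>(p, a) \<in> (SIGMA p : {p \<in> ?AB. m - p \<in> ?C}. {a \<in> ?A. p - a \<in> ?B}). coeff s a * coeff t (p - a) * coeff u (m - p))"
    by (rule sum.Sigma) (auto intro: finite_decomp[OF AB wb(3)] finite_decomp[OF wb(1,2)])
  also have "\<dots> = (\<Sum>(a, q) \<in> (SIGMA a : {a \<in> ?A. m - a \<in> ?BC}. {b \<in> ?B. (m - a) - b \<in> ?C}). coeff s a * (coeff t q * coeff u ((m - a) - q)))"
  proof (rule sum.reindex_bij_witness[of _ "\<lambda>(a, b). (a + b, a)" "\<lambda>(p, a). (a, p - a)"], goal_cases)
    case (2 x)
    obtain p a where x: "x = (p, a)" by force
    have h: "m - p \<in> ?C" "a \<in> ?A" "p - a \<in> ?B" using 2 x by auto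
    then have "(p - a, m - p) \<in> ?B \<times> ?C" "m - a = (p - a) + (m - p)" by auto
    then have "m - a \<in> ?BC" by (intro image_eqI[of _ _ "(p - a, m - p)"]) auto
    then show ?case using h x by (simp add: algebra_simps)
  next
    case (4 y)
    obtain a b where y: "y = (a, b)" by force
    have h: "a \<in> ?A" "b \<in> ?B" "m - a - b \<in> ?C" using 4 y by auto
    then have "a + b \<in> ?AB" by force
    then show ?case using h y by (simp add: algebra_simps)
  qed (auto simp: algebra_simps)
  also have "\<dots> = (\<Sum>a | a \<in> ?A \<and> m - a \<in> ?BC. \<Sum>b | b \<in> ?B \<and> (m - a) - b \<in> ?C. coeff s a * (coeff t b * coeff u ((m - a) - b)))"
    by (rule sum.Sigma[symmetric]) (auto intro: finite_decomp[OF wb(1) BC] finite_decomp[OF wb(2,3)])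
  also have "\<dots> = (\<Sum>a | a \<in> ?A \<and> m - a \<in> ?BC. coeff s a * coeff (t * u) (m - a))"
    by (subst coeff_times[OF order_refl wb(2) order_refl wb(3)]) (simp add: sum_distrib_left)
  also have "\<dots> = coeff (s * (t * u)) m"
    by (rule coeff_times[OF order_refl wb(1) supp_times BC, symmetric])
  finally show "coeff ((s * t) * u) m = coeff (s * (t * u)) m" .
qed

instance
proof
  fix a b c :: "('a, 'b, 'c) series"
  show "a + b + c = a + (b + c)" by transfer (auto simp: add.assoc)
  show "a + b = b + a" by transfer (auto simp: add.commute)
  show "0 + a = a" by transfer auto
  show "- a + a = 0" by transfer auto
  show "a - b = a + - b" by transfer auto
  show "(0::('a, 'b, 'c) series) \<noteq> 1" by transfer (metis zero_neq_one)
  show "a * b * c = a * (b * c)" by (rule times_assoc_series)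
  show "a * b = b * a" by (rule times_comm_series)
  show "1 * a = a"
  proof (rule series_eqI)
    fix m
    have "coeff (1 * a) m = (\<Sum>n | n \<in> {0} \<and> m - n \<in> supp a. coeff 1 n * coeff a (m - n))"
      by (rule coeff_times) (auto simp: supp_def one_series.rep_eq well_based_finite well_based_supp[unfolded supp_def] split: if_splits)
    also have "{n. n \<in> {0} \<and> m - n \<in> supp a} = (if m \<in> supp a then {0} else {})" by auto
    also have "(\<Sum>n \<in> \<dots>. coeff 1 n * coeff a (m - n)) = coeff a m"
      by (simp add: one_series.rep_eq supp_def)
    finally show "coeff (1 * a) m = coeff a m" .
  qed
  show "(a + b) * c = a * c + b * c"
  proof (rule series_eqI)
    fix m
    let ?A = "supp a \<union> supp b"
    have wb: "well_based ?A" by (simp add: well_based_Un well_based_supp)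
    have sub: "supp (a + b) \<subseteq> ?A" by (auto simp: supp_def plus_series.rep_eq)
    show "coeff ((a + b) * c) m = coeff (a * c + b * c) m"
      unfolding plus_series.rep_eq
        coeff_times[OF sub wb order_refl well_based_supp]
        coeff_times[of a, OF Un_upper1 wb order_refl well_based_supp]
        coeff_times[of b, OF Un_upper2 wb order_refl well_based_supp]
      by (simp add: plus_series.rep_eq distrib_right sum.distrib)
  qed
qed

end

definition dom_monom :: "('r::zero, 'n::linorder, 'k) series \<Rightarrow> 'n"
  where "dom_monom s = (GREATEST m. m \<in> supp s)"

lemma dom_monom:
  assumes "s \<noteq> (0 :: ('r::linordered_field, 'n::linordered_ab_group_add, 'k::regular_uncountable) series)"
  shows "dom_monom s \<in> supp s" and "m \<in> supp s \<Longrightarrow> m \<le> dom_monom s"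
proof -
  have "supp s \<noteq> {}" using assms series_eqI[of s 0] by (auto simp: supp_def zero_series.rep_eq)
  then obtain x where x: "x \<in> supp s" "\<forall>n\<in>supp s. n \<le> x"
    using well_based_supp[of s] unfolding well_based_alt by blast
  then have "dom_monom s = x" unfolding dom_monom_def by (intro Greatest_equality) auto
  then show "dom_monom s \<in> supp s" "m \<in> supp s \<Longrightarrow> m \<le> dom_monom s" using x by auto
qed

lemma dom_monomI:
  assumes "coeff s x \<noteq> 0" "\<And>m. x < m \<Longrightarrow> coeff s m = 0"
  shows "dom_monom s = x"
  unfolding dom_monom_def supp_def using assms
  by (intro Greatest_equality) (auto simp: not_less[symmetric])

definition pos :: "('r::linordered_field, 'n::linordered_ab_group_add, 'k::regular_uncountable) series \<Rightarrow> bool"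
  where "pos s \<longleftrightarrow> s \<noteq> 0 \<and> 0 < coeff s (dom_monom s)"

lemma above_dom_monom:
  "s \<noteq> 0 \<Longrightarrow> dom_monom s < m \<Longrightarrow> coeff s m = 0"
  for s :: "('r::linordered_field, 'n::linordered_ab_group_add, 'k::regular_uncountable) series"
  using dom_monom(2)[of s m] by (force simp: supp_def)

lemma posI: "0 < coeff s x \<Longrightarrow> (\<And>m. x < m \<Longrightarrow> coeff s m = 0) \<Longrightarrow> pos s"
  unfolding pos_def using dom_monomI[of s x] by (auto simp: zero_series.rep_eq)

lemma pos_add: "pos s \<Longrightarrow> pos t \<Longrightarrow> pos (s + t)"
  for s :: "('r::linordered_field, 'n::linordered_ab_group_add, 'k::regular_uncountable) series"
proof -
  assume s: "pos s" and t: "pos t"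
  have *: "pos (s + t)" if "pos s" "pos t" "dom_monom t \<le> dom_monom s" for s t :: "('r, 'n, 'k) series"
  proof (rule posI[of _ "dom_monom s"])
    have "0 \<le> coeff t (dom_monom s)"
      using that above_dom_monom[of t "dom_monom s"] unfolding pos_def by (cases "dom_monom t = dom_monom s") auto
    then show "0 < coeff (s + t) (dom_monom s)" using that by (simp add: pos_def plus_series.rep_eq)
    show "coeff (s + t) m = 0" if "dom_monom s < m" for m
      using that \<open>pos s\<close> \<open>pos t\<close> \<open>dom_monom t \<le> _\<close> above_dom_monom[of s m] above_dom_monom[of t m]
      by (simp add: pos_def plus_series.rep_eq)
  qed
  show ?thesis using *[OF s t] *[OF t s] by (metis add.commute linear)
qed

lemma pos_mult: "pos s \<Longrightarrow> pos t \<Longrightarrow> pos (s * t)"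
  for s :: "('r::linordered_field, 'n::linordered_ab_group_add, 'k::regular_uncountable) series"
proof (rule posI[of _ "dom_monom s + dom_monom t"])
  assume s: "pos s" and t: "pos t"
  let ?m = "dom_monom s + dom_monom t"
  have "{a. coeff s a \<noteq> 0 \<and> coeff t (?m - a) \<noteq> 0} = {dom_monom s}"
  proof -
    have "a = dom_monom s" if "coeff s a \<noteq> 0" "coeff t (?m - a) \<noteq> 0" for a
    proof -
      have "a \<le> dom_monom s" "?m - a \<le> dom_monom t"
        using that s t dom_monom(2)[of s a] dom_monom(2)[of t "?m - a"] by (auto simp: supp_def pos_def)
      then show ?thesis by (simp add: algebra_simps)
    qed
    then show ?thesis using s t by (auto simp: pos_def)
  qed
  then show "0 < coeff (s * t) ?m" using s t by (simp add: times_series.rep_eq pos_def)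
  fix m assume m: "?m < m"
  have "{a. coeff s a \<noteq> 0 \<and> coeff t (m - a) \<noteq> 0} = {}"
  proof -
    have False if "coeff s a \<noteq> 0" "coeff t (m - a) \<noteq> 0" for a
    proof -
      have "a \<le> dom_monom s" "m - a \<le> dom_monom t"
        using that s t dom_monom(2)[of s a] dom_monom(2)[of t "m - a"] by (auto simp: supp_def pos_def)
      then have "a + (m - a) \<le> ?m" by (rule add_mono)
      then show False using m by simp
    qed
    then show ?thesis by auto
  qed
  then show "coeff (s * t) m = 0" by (simp only: times_series.rep_eq sum.empty)
qed

lemma pos_trichotomy: "s = 0 \<or> pos s \<or> pos (- s)"
  for s :: "('r::linordered_field, 'n::linordered_ab_group_add, 'k::regular_uncountable) series"
proof (cases "s = 0")
  case False
  have "dom_monom (- s) = dom_monom s" by (simp add: dom_monom_def supp_def uminus_series.rep_eq)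
  moreover have "coeff s (dom_monom s) \<noteq> 0" using dom_monom(1)[OF False] by (simp add: supp_def)
  ultimately show ?thesis using False by (auto simp: pos_def uminus_series.rep_eq)
qed auto

lemma not_pos_0: "\<not> pos 0" by (simp add: pos_def)

instantiation series :: (linordered_field, linordered_ab_group_add, regular_uncountable) ord
begin

definition less_series :: "('a, 'b, 'c) series \<Rightarrow> ('a, 'b, 'c) series \<Rightarrow> bool"
  where "s < t \<longleftrightarrow> t - s \<noteq> 0 \<and> 0 < coeff (t - s) (dom_monom (t - s))"

definition less_eq_series :: "('a, 'b, 'c) series \<Rightarrow> ('a, 'b, 'c) series \<Rightarrow> bool"
  where "s \<le> t \<longleftrightarrow> s = t \<or> pos (t - s)"

instance ..

end

instantiation series :: (linordered_field, linordered_ab_group_add, regular_uncountable) linordered_idom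
begin

definition abs_series :: "('a, 'b, 'c) series \<Rightarrow> ('a, 'b, 'c) series"
  where "\<bar>s :: ('a, 'b, 'c) series\<bar> = (if s < 0 then - s else s)"

definition sgn_series :: "('a, 'b, 'c) series \<Rightarrow> ('a, 'b, 'c) series"
  where "sgn (s :: ('a, 'b, 'c) series) = (if s = 0 then 0 else if 0 < s then 1 else - 1)"

lemma less_series_pos: "s < t \<longleftrightarrow> pos (t - s)" for s t :: "('a, 'b, 'c) series"
  by (simp add: less_series_def pos_def)

instance
proof
  fix a b c :: "('a, 'b, 'c) series"
  have asym: "\<not> pos (x - y)" if "pos (y - x)" for x y :: "('a, 'b, 'c) series"
    using pos_add[OF that, of "x - y"] not_pos_0 by auto
  show "(a < b) = (a \<le> b \<and> \<not> b \<le> a)"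
    using asym by (auto simp: less_eq_series_def less_series_pos not_pos_0)
  show "a \<le> a" by (simp add: less_eq_series_def)
  show "a \<le> b \<Longrightarrow> b \<le> c \<Longrightarrow> a \<le> c"
    using pos_add[of "b - a" "c - b"] by (auto simp: less_eq_series_def less_series_pos)
  show "a \<le> b \<Longrightarrow> b \<le> a \<Longrightarrow> a = b"
    using asym by (auto simp: less_eq_series_def less_series_pos)
  show "a \<le> b \<or> b \<le> a"
    using pos_trichotomy[of "b - a"] by (auto simp: less_eq_series_def less_series_pos)
  show "a \<le> b \<Longrightarrow> c + a \<le> c + b" by (auto simp: less_eq_series_def less_series_pos)
  show "a < b \<Longrightarrow> 0 < c \<Longrightarrow> c * a < c * b"
    using pos_mult[of c "b - a"] by (simp add: less_series_pos right_diff_distrib)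
  show "\<bar>a\<bar> = (if a < 0 then - a else a)" by (rule abs_series_def)
  show "sgn a = (if a = 0 then 0 else if 0 < a then 1 else - 1)" by (rule sgn_series_def)
qed

end

lift_definition scalar :: "'r::linordered_field \<Rightarrow> ('r, 'n::linordered_ab_group_add, 'k::regular_uncountable) series"
  is "\<lambda>r m. if m = 0 then r else 0"
  by (rule conjI; rule well_based_finite small_finite, rule finite_subset[of _ "{0}"]) auto

lift_definition monom :: "'n \<Rightarrow> ('r::linordered_field, 'n::linordered_ab_group_add, 'k::regular_uncountable) series"
  is "\<lambda>n m. if m = n then 1 else 0"
  by (simp add: well_based_finite small_finite)

definition series_prec ::
  "('r::linordered_field, 'n::linordered_ab_group_add, 'k::regular_uncountable) series \<Rightarrow> ('r, 'n, 'k) series \<Rightarrow> bool"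
    (infix "\<prec>" 50)
  where "s \<prec> t \<longleftrightarrow> (\<forall>r>0. scalar r * \<bar>s\<bar> < \<bar>t\<bar>)"

definition series_preceq ::
  "('r::linordered_field, 'n::linordered_ab_group_add, 'k::regular_uncountable) series \<Rightarrow> ('r, 'n, 'k) series \<Rightarrow> bool"
    (infix "\<preceq>" 50)
  where "s \<preceq> t \<longleftrightarrow> \<not> t \<prec> s"

definition purely_large ::
  "('r::linordered_field, 'n::linordered_ab_group_add, 'k::regular_uncountable) series set"
  where "purely_large = {s. \<forall>m\<in>supp s. 0 < m}"

definition pos_infinite ::
  "('r::linordered_field, 'n::linordered_ab_group_add, 'k::regular_uncountable) series set"
  where "pos_infinite = {s. \<forall>r. scalar r < s}"

definition series_over ::
  "'n set \<Rightarrow> ('r::linordered_field, 'n::linordered_ab_group_add, 'k::regular_uncountable) series set"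
  where "series_over M = {s. supp s \<subseteq> M}"


section \<open>Summable families and strongly linear maps\<close>

definition summable_family ::
  "('i \<Rightarrow> ('r::linordered_field, 'n::linordered_ab_group_add, 'k::regular_uncountable) series) \<Rightarrow> 'i set \<Rightarrow> bool"
  where "summable_family f I \<longleftrightarrow>
    well_based (\<Union>i\<in>I. supp (f i)) \<and> small TYPE('k) (\<Union>i\<in>I. supp (f i)) \<and>
    (\<forall>m. finite {i\<in>I. m \<in> supp (f i)})"

definition has_family_sum ::
  "('i \<Rightarrow> ('r::linordered_field, 'n::linordered_ab_group_add, 'k::regular_uncountable) series) \<Rightarrow> 'i set \<Rightarrow> ('r, 'n, 'k) series \<Rightarrow> bool"
  where "has_family_sum f I s \<longleftrightarrow>
    summable_family f I \<and> (\<forall>m. coeff s m = (\<Sum>i | i \<in> I \<and> m \<in> supp (f i). coeff (f i) m))"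

lemma summable_family_sum_unique:
  fixes f :: "'i \<Rightarrow> ('r::linordered_field, 'n::linordered_ab_group_add, 'k::regular_uncountable) series"
  assumes "summable_family f I"
  shows "\<exists>!s. has_family_sum f I s"
proof -
  let ?c = "\<lambda>m. \<Sum>i | i \<in> I \<and> m \<in> supp (f i). coeff (f i) m"
  have "{m. ?c m \<noteq> 0} \<subseteq> (\<Union>i\<in>I. supp (f i))"
    by (auto elim!: sum.not_neutral_contains_not_neutral)
  then have "well_based {m. ?c m \<noteq> 0} \<and> small TYPE('k) {m. ?c m \<noteq> 0}"
    using assms unfolding summable_family_def by (meson well_based_subset small_subset)
  then have "coeff (Series ?c :: ('r, 'n, 'k) series) = ?c" by (simp add: Series_inverse)
  then have "has_family_sum f I (Series ?c)" using assms by (simp add: has_family_sum_def)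
  then show ?thesis by (rule ex1I) (rule series_eqI, use \<open>coeff _ = _\<close> in \<open>simp add: has_family_sum_def\<close>)
qed

text \<open>
  The index type \<^typ>\<open>'n \<times> nat\<close> accounts for families over arbitrary index classes: members
  equal to 0 do not matter to an additive map, and in a summable family only finitely many
  members have a given monomial in their support, so the nonzero ones can be indexed by pairs
  of a monomial and a number.
\<close>

definition strongly_linear ::
  "(('r::linordered_field, 'n::linordered_ab_group_add, 'k::regular_uncountable) series \<Rightarrow> ('r, 'n, 'k) series) \<Rightarrow> bool"
  where "strongly_linear \<Phi> \<longleftrightarrow>
    (\<forall>f g. \<Phi> (f + g) = \<Phi> f + \<Phi> g) \<and>
    (\<forall>r f. \<Phi> (scalar r * f) = scalar r * \<Phi> f) \<and>
    (\<forall>(f :: 'n \<times> nat \<Rightarrow> ('r, 'n, 'k) series) I s.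
      has_family_sum f I s \<longrightarrow> has_family_sum (\<lambda>i. \<Phi> (f i)) I (\<Phi> s))"


section \<open>Transserial fields\<close>

definition transserial_field ::
  "(('r::linordered_field, 'n::linordered_ab_group_add, 'k::regular_uncountable) series \<Rightarrow> ('r, 'n, 'k) series) \<Rightarrow> bool"
  where "transserial_field log \<longleftrightarrow>
    (\<forall>s>0. \<forall>t>0. log (s * t) = log s + log t) \<and>
    (\<forall>s>0. \<forall>t>0. s < t \<longleftrightarrow> log s < log t) \<and>
    (\<forall>m. log (monom m) \<in> purely_large) \<and>
    (\<forall>s>0. log s \<le> s - 1) \<and>
    (\<forall>\<epsilon>. \<epsilon> \<prec> 1 \<longrightarrow> has_family_sum (\<lambda>k::nat. scalar ((- 1) ^ (k + 1) / of_nat k) * \<epsilon> ^ k) {0<..} (log (1 + \<epsilon>))) \<and>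
    bij_betw log (scalar ` {0<..}) (range scalar)"

definition exponentially_closed ::
  "(('r::linordered_field, 'n::linordered_ab_group_add, 'k::regular_uncountable) series \<Rightarrow> ('r, 'n, 'k) series) \<Rightarrow> bool"
  where "exponentially_closed log \<longleftrightarrow> log ` {0<..} = UNIV"

definition flatter ::
  "(('r::linordered_field, 'n::linordered_ab_group_add, 'k::regular_uncountable) series \<Rightarrow> ('r, 'n, 'k) series) \<Rightarrow>
    ('r, 'n, 'k) series \<Rightarrow> ('r, 'n, 'k) series \<Rightarrow> bool"
  where "flatter log s t \<longleftrightarrow> log \<bar>s\<bar> \<prec> log \<bar>t\<bar>"

definition flatter_eq ::
  "(('r::linordered_field, 'n::linordered_ab_group_add, 'k::regular_uncountable) series \<Rightarrow> ('r, 'n, 'k) series) \<Rightarrow>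
    ('r, 'n, 'k) series \<Rightarrow> ('r, 'n, 'k) series \<Rightarrow> bool"
  where "flatter_eq log s t \<longleftrightarrow> log \<bar>s\<bar> \<preceq> log \<bar>t\<bar>"


section \<open>Derivations\<close>

text \<open>The last clause is \<open>\<partial>(log |s|) = \<partial>(s) / s\<close>, with the denominator cleared.\<close>

definition transserial_derivation ::
  "(('r::linordered_field, 'n::linordered_ab_group_add, 'k::regular_uncountable) series \<Rightarrow> ('r, 'n, 'k) series) \<Rightarrow>
    (('r, 'n, 'k) series \<Rightarrow> ('r, 'n, 'k) series) \<Rightarrow> bool"
  where "transserial_derivation log D \<longleftrightarrow>
    strongly_linear D \<and>
    (\<forall>f g. D (f * g) = D f * g + f * D g) \<and>
    (\<forall>s. s \<noteq> 0 \<longrightarrow> s * D (log \<bar>s\<bar>) = D s)"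

definition derivation_identity ::
  "(('r::linordered_field, 'n::linordered_ab_group_add, 'k::regular_uncountable) series \<Rightarrow> ('r, 'n, 'k) series) \<Rightarrow>
    ('r, 'n, 'k) series \<Rightarrow> bool"
  where "derivation_identity D x \<longleftrightarrow> 0 < x \<and> 0 \<notin> supp x \<and> D x = 1"

definition H_field ::
  "(('r::linordered_field, 'n::linordered_ab_group_add, 'k::regular_uncountable) series \<Rightarrow> ('r, 'n, 'k) series) \<Rightarrow> bool"
  where "H_field D \<longleftrightarrow> {f. D f = 0} = range scalar \<and> (\<forall>f\<in>pos_infinite. 0 < D f)"

definition flat_derivation ::
  "(('r::linordered_field, 'n::linordered_ab_group_add, 'k::regular_uncountable) series \<Rightarrow> ('r, 'n, 'k) series) \<Rightarrow>
    (('r, 'n, 'k) series \<Rightarrow> ('r, 'n, 'k) series) \<Rightarrow> ('r, 'n, 'k) series \<Rightarrow> bool"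
  where "flat_derivation log D x \<longleftrightarrow>
    (\<forall>m. \<forall>n\<in>supp (D (monom m)). \<exists>f w.
      flatter log (monom f) (monom m) \<and> flatter_eq log (monom w) x \<and> n = m + f + w)"


section \<open>Composition laws\<close>

text \<open>
  The values \<open>cmp f s\<close>, read \<open>f \<circ> s\<close>, matter only for \<open>s \<in> pos_infinite\<close>.
  Likewise \<open>log\<close> matters only on positive series.
\<close>

definition transserial_composition ::
  "(('r::linordered_field, 'n::linordered_ab_group_add, 'k::regular_uncountable) series \<Rightarrow> ('r, 'n, 'k) series) \<Rightarrow>
    (('r, 'n, 'k) series \<Rightarrow> ('r, 'n, 'k) series \<Rightarrow> ('r, 'n, 'k) series) \<Rightarrow> bool"
  where "transserial_composition log cmp \<longleftrightarrow>
    (\<forall>s\<in>pos_infinite.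
      strongly_linear (\<lambda>f. cmp f s) \<and>
      cmp 1 s = 1 \<and>
      (\<forall>f g. cmp (f * g) s = cmp f s * cmp g s) \<and>
      strict_mono (\<lambda>f. cmp f s) \<and>
      (\<forall>f>0. cmp (log f) s = log (cmp f s))) \<and>
    (\<forall>f. \<forall>s\<in>pos_infinite. \<forall>t\<in>pos_infinite. cmp f (cmp s t) = cmp (cmp f s) t)"

definition composition_identity ::
  "(('r::linordered_field, 'n::linordered_ab_group_add, 'k::regular_uncountable) series \<Rightarrow> ('r, 'n, 'k) series \<Rightarrow> ('r, 'n, 'k) series) \<Rightarrow>
    ('r, 'n, 'k) series \<Rightarrow> bool"
  where "composition_identity cmp x \<longleftrightarrow>
    x \<in> pos_infinite \<and> (\<forall>s\<in>pos_infinite. cmp x s = s) \<and> (\<forall>f. cmp f x = f)"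

definition flat_composition ::
  "(('r::linordered_field, 'n::linordered_ab_group_add, 'k::regular_uncountable) series \<Rightarrow> ('r, 'n, 'k) series) \<Rightarrow>
    (('r, 'n, 'k) series \<Rightarrow> ('r, 'n, 'k) series \<Rightarrow> ('r, 'n, 'k) series) \<Rightarrow> bool"
  where "flat_composition log cmp \<longleftrightarrow>
    (\<forall>s\<in>pos_infinite. \<forall>m. m \<noteq> 0 \<longrightarrow> (\<forall>n\<in>supp (cmp (monom m) s). \<exists>f w. \<exists>u\<in>supp s.
      flatter log (monom f) (monom m) \<and>
      monom w \<preceq> (1 :: ('r, 'n, 'k) series) \<and> flatter_eq log (monom w) (monom u) \<and>
      n = dom_monom (cmp (monom m) s) + f + w))"

definition chain_rule ::
  "(('r::linordered_field, 'n::linordered_ab_group_add, 'k::regular_uncountable) series \<Rightarrow> ('r, 'n, 'k) series) \<Rightarrow>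
    (('r, 'n, 'k) series \<Rightarrow> ('r, 'n, 'k) series \<Rightarrow> ('r, 'n, 'k) series) \<Rightarrow> bool"
  where "chain_rule D cmp \<longleftrightarrow> (\<forall>f. \<forall>s\<in>pos_infinite. D (cmp f s) = D s * cmp (D f) s)"

definition taylor_configuration ::
  "(('r::linordered_field, 'n::linordered_ab_group_add, 'k::regular_uncountable) series \<Rightarrow> ('r, 'n, 'k) series) \<Rightarrow>
    (('r, 'n, 'k) series \<Rightarrow> ('r, 'n, 'k) series \<Rightarrow> ('r, 'n, 'k) series) \<Rightarrow>
    ('r, 'n, 'k) series \<Rightarrow> ('r, 'n, 'k) series \<Rightarrow> ('r, 'n, 'k) series \<Rightarrow> bool"
  where "taylor_configuration D cmp f s \<delta> \<longleftrightarrow>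
    s \<in> pos_infinite \<and> \<delta> \<prec> s \<and>
    (\<forall>m\<in>supp f. cmp (D (monom m)) s * \<delta> \<prec> cmp (monom m) s)"

definition taylor_expansions ::
  "(('r::linordered_field, 'n::linordered_ab_group_add, 'k::regular_uncountable) series \<Rightarrow> ('r, 'n, 'k) series) \<Rightarrow>
    (('r, 'n, 'k) series \<Rightarrow> ('r, 'n, 'k) series \<Rightarrow> ('r, 'n, 'k) series) \<Rightarrow> bool"
  where "taylor_expansions D cmp \<longleftrightarrow> (\<forall>f s \<delta>. taylor_configuration D cmp f s \<delta> \<longrightarrow>
    summable_family (\<lambda>(m, k). cmp ((D ^^ k) (monom m)) s * \<delta> ^ k) (supp f \<times> UNIV) \<and>
    has_family_sum (\<lambda>k. scalar (1 / fact k) * cmp ((D ^^ k) f) s * \<delta> ^ k) UNIV (cmp f (s + \<delta>)) \<and>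
    has_family_sum (\<lambda>(m, k). scalar (coeff f m / fact k) * cmp ((D ^^ k) (monom m)) s * \<delta> ^ k)
      (supp f \<times> UNIV) (cmp f (s + \<delta>)) \<and>
    (\<forall>k. cmp ((D ^^ k) f) s * \<delta> ^ k \<noteq> 0 \<longrightarrow>
      cmp ((D ^^ (k + 1)) f) s * \<delta> ^ (k + 1) \<prec> cmp ((D ^^ k) f) s * \<delta> ^ k))"


section \<open>Groups of monomials and of series\<close>

definition monomial_group :: "'n::linordered_ab_group_add monoid"
  where "monomial_group = \<lparr>carrier = UNIV, monoid.mult = (+), one = 0\<rparr>"

definition tangent_series ::
  "('r::linordered_field, 'n::linordered_ab_group_add, 'k::regular_uncountable) series \<Rightarrow> 'n set \<Rightarrow> ('r, 'n, 'k) series set"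
  where "tangent_series x M = {x + \<delta> | \<delta>. \<delta> \<in> series_over M \<and> \<delta> \<prec> x}"

end

theory Submission
  imports Defs
begin

text \<open>
  Composition with elements of \<open>\<G> = {x + \<delta>}\<close> is associative with identity \<open>x\<close>, and \<open>\<G>\<close> is closed under
  it because \<open>f \<circ> s\<close> is the sum of the \<open>f(m) (m \<circ> s)\<close> and \<open>f \<mapsto> f \<circ> s\<close> preserves \<open>\<prec>\<close>. The point is the
  existence of right inverses: \<open>x + \<epsilon>\<close> is one of \<open>x + \<delta>\<close> exactly when \<open>\<epsilon>\<close> is a fixed point of
  \<open>\<Phi>(\<epsilon>) = - \<delta> \<circ> (x + \<epsilon>)\<close>.

  The map \<open>\<Phi>\<close> is contracting: if \<open>f \<prec> x\<close>, and \<open>\<eta> \<noteq> 0\<close> is \<open>\<prec> s\<close> and \<open>\<prec> s + \<eta>\<close>, both positive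
  infinite, then \<open>f \<circ> (s + \<eta>) - f \<circ> s \<prec> \<eta>\<close> (\<open>difference_prec\<close>). It suffices to take a monomial \<open>m \<prec> x\<close> for \<open>f\<close>; then \<open>m' \<prec> 1\<close> since the
  field is an H-field. If \<open>m\<close> has a Taylor expansion at \<open>(s, \<eta>)\<close> or at \<open>(s + \<eta>, -\<eta>)\<close>, its term of order
  one, and hence the difference, is \<open>\<prec> \<eta>\<close>. If it has neither, then \<open>m \<circ> s\<close> is bounded by a multiple of
  \<open>(m' \<circ> s) \<eta> \<prec> \<eta>\<close>, likewise at \<open>s + \<eta>\<close>, and both terms of the difference are \<open>\<prec> \<eta>\<close>.

  For a contracting \<open>\<Phi>\<close>, the series that agree with their image down to the bottom of their support
  are truncations of one another. Their union is a coefficient function \<open>c\<close> with well-based support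
  \<open>W\<close>; if \<open>W\<close> is small, \<open>c\<close> is a series, and it is a fixed point, since otherwise it could be continued
  (\<open>contracting_fixed_point\<close>).

  It remains to see that \<open>W\<close> is small (\<open>right_inverse\<close>). For \<open>w \<in> W\<close> let \<open>t\<^sub>w\<close> be the part of \<open>c\<close> above \<open>w\<close>.
  Then \<open>w\<close> lies in the support of \<open>m \<circ> (x + t\<^sub>w)\<close> for some \<open>m \<in> supp \<delta>\<close>. By the dichotomy above this
  forces \<open>m\<close> to be in Taylor configuration at \<open>(x + t\<^sub>p, p)\<close> for \<open>p = w\<close>. Fix one such \<open>p \<in> W\<close> for each
  such \<open>m\<close>. For \<open>w \<prec> p\<close>, \<open>m \<circ> (x + t\<^sub>w)\<close> is then given by a Taylor expansion at
  \<open>x + t\<^sub>p\<close> in powers of \<open>t\<^sub>w - t\<^sub>p\<close>, so \<open>w\<close> is a product of a monomial in the support of some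
  \<open>m\<^sup>(\<^sup>k\<^sup>) \<circ> (x + t\<^sub>p)\<close> and of larger elements of \<open>W\<close>. The elements \<open>\<succeq> p\<close> of \<open>W\<close> form a small set. By
  induction \<open>W\<close> lies in the monoid generated by small sets indexed by the small set \<open>supp \<delta>\<close>, which
  is small by regularity.
\<close>

section \<open>Small sets\<close>

lemma small_UN:
  assumes "small TYPE('k::regular_uncountable) I" "\<And>i. i \<in> I \<Longrightarrow> small TYPE('k) (A i)"
  shows "small TYPE('k) (\<Union>i\<in>I. A i)"
proof -
  have "Cinfinite |UNIV :: 'k set|"
    using infinite_regular by (simp add: cinfinite_def card_of_card_order_on Field_card_of)
  then show ?thesis
    using assms regularCard_UNION_bound[OF _ regularCard_UNIV[where 'a='k]]
    unfolding small_def by blast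
qed

lemma small_insert: "small TYPE('k::regular_uncountable) A \<Longrightarrow> small TYPE('k) (insert a A)"
  using small_Un[of "{a}" A] by (simp add: small_finite)

lemma small_nat: "small TYPE('k::regular_uncountable) (UNIV :: nat set)"
  unfolding small_def using card_of_nat uncountable_UNIV ordIso_ordLess_trans by blast

text \<open>The submonoid generated by \<open>B\<close>, written additively.\<close>

definition sums_of :: "'n::monoid_add set \<Rightarrow> 'n set"
  where "sums_of B = {sum_list ns | ns. set ns \<subseteq> B}"

lemma sums_of_incl: "b \<in> B \<Longrightarrow> b \<in> sums_of B"
  unfolding sums_of_def by (auto intro!: exI[of _ "[b]"])

lemma sums_of_add: "a \<in> sums_of B \<Longrightarrow> b \<in> sums_of B \<Longrightarrow> a + b \<in> sums_of B"
  unfolding sums_of_def by (auto, metis le_sup_iff set_append sum_list.append)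

lemma sums_of_sums: "A \<subseteq> sums_of B \<Longrightarrow> sums_of A \<subseteq> sums_of B"
proof -
  assume A: "A \<subseteq> sums_of B"
  have "sum_list ns \<in> sums_of B" if "set ns \<subseteq> A" for ns
    using that
  proof (induction ns)
    case Nil
    show ?case unfolding sums_of_def by (auto intro!: exI[of _ "[]"])
  next
    case (Cons n ns)
    then show ?case using A by (auto intro!: sums_of_add)
  qed
  then show ?thesis unfolding sums_of_def[of A] by blast
qed

lemma small_sums_of:
  fixes B :: "'n::monoid_add set"
  assumes "small TYPE('k::regular_uncountable) B"
  shows "small TYPE('k) (sums_of B)"
proof -
  define F where "F j = {sum_list ns | ns. set ns \<subseteq> B \<and> length ns = j}" for j
  have "small TYPE('k) (F j)" for j
  proof (induction j)
    case 0
    have "F 0 = {0}" unfolding F_def by auto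
    then show ?case by (simp add: small_finite)
  next
    case (Suc j)
    have "F (Suc j) \<subseteq> (\<lambda>(a, b). a + b) ` (B \<times> F j)"
      unfolding F_def by (force simp: length_Suc_conv)
    moreover have "small TYPE('k) ((\<lambda>(a, b). a + b) ` (B \<times> F j))"
      by (intro small_image small_Times assms Suc)
    ultimately show ?case by (rule small_subset)
  qed
  then have "small TYPE('k) (\<Union>j\<in>UNIV. F j)" by (intro small_UN small_nat)
  moreover have "sums_of B \<subseteq> (\<Union>j\<in>UNIV. F j)" unfolding sums_of_def F_def by blast
  ultimately show ?thesis by (meson small_subset)
qed


section \<open>Coefficients and the dominance relation\<close>

lemma supp_iff: "m \<in> supp s \<longleftrightarrow> coeff s m \<noteq> 0"
  by (simp add: supp_def)

lemma supp_plus: "supp (s + t) \<subseteq> supp s \<union> supp t"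
  by (auto simp: supp_iff plus_series.rep_eq)

lemma coeff_scalar_times:
  fixes s :: "('r::linordered_field, 'n::linordered_ab_group_add, 'k::regular_uncountable) series"
  shows "coeff (scalar r * s) m = r * coeff s m"
proof -
  let ?r = "scalar r :: ('r, 'n, 'k) series"
  have "coeff (?r * s) m = (\<Sum>a | a \<in> {0} \<and> m - a \<in> supp s. coeff ?r a * coeff s (m - a))"
    by (rule coeff_times) (auto simp: supp_def scalar.rep_eq well_based_finite well_based_supp[unfolded supp_def])
  also have "{a. a \<in> {0} \<and> m - a \<in> supp s} = (if m \<in> supp s then {0} else {})" by auto
  also have "(\<Sum>a \<in> \<dots>. coeff ?r a * coeff s (m - a)) = r * coeff s m"
    by (simp add: scalar.rep_eq supp_def)
  finally show ?thesis .
qed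

lemma scalar_1: "scalar 1 = 1"
  by (rule series_eqI) (simp add: scalar.rep_eq one_series.rep_eq)

lemma scalar_add: "scalar (r + q) = scalar r + scalar q"
  by (rule series_eqI) (simp add: scalar.rep_eq plus_series.rep_eq)

lemma scalar_mult: "scalar (r * q) = scalar r * scalar q"
  by (rule series_eqI) (simp add: scalar.rep_eq coeff_scalar_times)

lemma scalar_uminus: "scalar (- r) = - scalar r"
  by (rule series_eqI) (simp add: scalar.rep_eq uminus_series.rep_eq)

lemma scalar_pos:
  assumes "0 < r"
  shows "0 < (scalar r :: ('r::linordered_field, 'n::linordered_ab_group_add, 'k::regular_uncountable) series)"
  unfolding less_series_pos using assms
  by (intro posI[of _ 0]) (auto simp: scalar.rep_eq)

lemma coeff_abs: "coeff \<bar>s\<bar> m = (if s < 0 then - coeff s m else coeff s m)"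
  by (simp add: abs_series_def uminus_series.rep_eq)

lemma coeff_abs_dom_pos: "s \<noteq> 0 \<Longrightarrow> 0 < coeff \<bar>s\<bar> (dom_monom s)"
proof -
  fix s :: "('r::linordered_field, 'n::linordered_ab_group_add, 'k::regular_uncountable) series"
  assume "s \<noteq> 0"
  have eq: "supp \<bar>s\<bar> = supp s" by (simp add: supp_def coeff_abs)
  have "0 < \<bar>s\<bar>" using \<open>s \<noteq> 0\<close> by simp
  then have "pos \<bar>s\<bar>" by (simp add: less_series_pos)
  then show "0 < coeff \<bar>s\<bar> (dom_monom s)" by (simp add: pos_def dom_monom_def eq)
qed

text \<open>
  \<open>s \<prec> t\<close> says that \<open>s\<close> has no coefficient at or above the dominant monomial of \<open>t\<close>; in particular
  nothing is \<open>\<prec> 0\<close>.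
\<close>

lemma prec_iff:
  fixes s t :: "('r::linordered_field, 'n::linordered_ab_group_add, 'k::regular_uncountable) series"
  shows "s \<prec> t \<longleftrightarrow> t \<noteq> 0 \<and> (\<forall>n\<ge>dom_monom t. coeff s n = 0)"
proof (intro iffI conjI allI impI)
  assume st: "s \<prec> t"
  have "scalar 1 * \<bar>s\<bar> < \<bar>t\<bar>" using st unfolding series_prec_def by (meson zero_less_one)
  then show t0: "t \<noteq> 0" by (auto simp: scalar_1)
  fix n assume n: "dom_monom t \<le> n"
  show "coeff s n = 0"
  proof (rule ccontr)
    assume c: "coeff s n \<noteq> 0"
    then have s0: "s \<noteq> 0" by (auto simp: zero_series.rep_eq)
    let ?d = "dom_monom s"
    have d: "dom_monom t \<le> ?d" using dom_monom(2)[OF s0, of n] c n by (auto simp: supp_iff)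
    let ?c = "coeff \<bar>s\<bar> ?d"
    have cp: "0 < ?c" using coeff_abs_dom_pos[OF s0] .
    define r where "r = \<bar>coeff \<bar>t\<bar> ?d\<bar> / ?c + 1"
    have r: "0 < r" unfolding r_def using cp by (simp add: add_nonneg_pos)
    have "r * ?c = \<bar>coeff \<bar>t\<bar> ?d\<bar> + ?c" unfolding r_def using cp by (simp add: field_simps)
    then have "0 < coeff (scalar r * \<bar>s\<bar> - \<bar>t\<bar>) ?d"
      using cp by (simp add: minus_series.rep_eq coeff_scalar_times)
    moreover have "coeff (scalar r * \<bar>s\<bar> - \<bar>t\<bar>) m = 0" if "?d < m" for m
      using above_dom_monom[OF s0 that] above_dom_monom[OF t0, of m] d that
      by (simp add: minus_series.rep_eq coeff_scalar_times coeff_abs)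
    ultimately have "pos (scalar r * \<bar>s\<bar> - \<bar>t\<bar>)" by (rule posI)
    then have "\<bar>t\<bar> < scalar r * \<bar>s\<bar>" by (simp add: less_series_pos)
    then show False using st r unfolding series_prec_def by (meson less_asym)
  qed
next
  assume t: "t \<noteq> 0 \<and> (\<forall>n\<ge>dom_monom t. coeff s n = 0)"
  show "s \<prec> t" unfolding series_prec_def
  proof (intro allI impI)
    fix r :: 'r assume "0 < r"
    have "pos (\<bar>t\<bar> - scalar r * \<bar>s\<bar>)"
      using t coeff_abs_dom_pos[of t] above_dom_monom[of t]
      by (intro posI[of _ "dom_monom t"]) (auto simp: minus_series.rep_eq coeff_scalar_times coeff_abs)
    then show "scalar r * \<bar>s\<bar> < \<bar>t\<bar>" by (simp add: less_series_pos)
  qed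
qed

lemma prec_0: "t \<noteq> 0 \<Longrightarrow> 0 \<prec> t"
  by (simp add: prec_iff zero_series.rep_eq)

lemma prec_uminus: "- s \<prec> t \<longleftrightarrow> s \<prec> t" "s \<prec> - t \<longleftrightarrow> s \<prec> t"
  by (simp_all add: series_prec_def)

lemma prec_diff: "s \<prec> u \<Longrightarrow> t \<prec> u \<Longrightarrow> s - t \<prec> u"
  by (simp add: prec_iff minus_series.rep_eq)

lemma prec_add: "s \<prec> u \<Longrightarrow> t \<prec> u \<Longrightarrow> s + t \<prec> u"
  by (simp add: prec_iff plus_series.rep_eq)

text \<open>The hypothesis \<open>\<not> t \<prec> s\<close> is \<open>s \<preceq> t\<close>.\<close>

lemma not_prec_prec_trans:
  fixes s t u :: "('r::linordered_field, 'n::linordered_ab_group_add, 'k::regular_uncountable) series"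
  assumes "\<not> t \<prec> s" "t \<prec> u" shows "s \<prec> u"
  unfolding series_prec_def
proof (intro allI impI)
  fix q :: 'r assume q: "0 < q"
  obtain r where r: "0 < r" "\<bar>s\<bar> \<le> scalar r * \<bar>t\<bar>"
    using assms(1) unfolding series_prec_def by (meson not_less)
  have "scalar q * \<bar>s\<bar> \<le> scalar q * (scalar r * \<bar>t\<bar>)"
    by (rule mult_left_mono[OF r(2)]) (simp add: scalar_pos[OF q] less_imp_le)
  also have "\<dots> = scalar (q * r) * \<bar>t\<bar>" by (simp add: scalar_mult mult.assoc)
  also have "\<dots> < \<bar>u\<bar>" using assms(2) q r(1) unfolding series_prec_def by simp
  finally show "scalar q * \<bar>s\<bar> < \<bar>u\<bar>" .
qed

lemma prec_asym: "s \<prec> t \<Longrightarrow> \<not> t \<prec> s"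
  unfolding series_prec_def by (metis less_asym mult_1 scalar_1 zero_less_one)

lemma prec_trans: "s \<prec> t \<Longrightarrow> t \<prec> u \<Longrightarrow> s \<prec> u"
  using not_prec_prec_trans prec_asym by blast

lemma prec_1_mult:
  fixes s u :: "('r::linordered_field, 'n::linordered_ab_group_add, 'k::regular_uncountable) series"
  assumes "s \<prec> 1" "u \<noteq> 0" shows "s * u \<prec> u"
  unfolding series_prec_def
proof (intro allI impI)
  fix r :: 'r assume "0 < r"
  then have "scalar r * \<bar>s\<bar> < 1" using assms(1) unfolding series_prec_def by simp
  then have "scalar r * \<bar>s\<bar> * \<bar>u\<bar> < 1 * \<bar>u\<bar>"
    using assms(2) by (intro mult_strict_right_mono) auto
  then show "scalar r * \<bar>s * u\<bar> < \<bar>u\<bar>" by (simp add: abs_mult mult.assoc)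
qed

lemma monom_neq_0: "monom m \<noteq> 0"
  by (metis monom.rep_eq zero_neq_one zero_series.rep_eq)

lemma dom_monom_monom:
  "dom_monom (monom m :: ('r::linordered_field, 'n::linordered_ab_group_add, 'k::regular_uncountable) series) = m"
  by (rule dom_monomI) (auto simp: monom.rep_eq)

lemma prec_monom_iff: "s \<prec> monom m \<longleftrightarrow> (\<forall>n\<in>supp s. n < m)"
  by (auto simp: prec_iff dom_monom_monom monom_neq_0 supp_iff not_le[symmetric])

lemma pos_infinite_add:
  fixes x \<epsilon> :: "('r::linordered_field, 'n::linordered_ab_group_add, 'k::regular_uncountable) series"
  assumes x: "x \<in> pos_infinite" and \<epsilon>: "\<epsilon> \<prec> x"
  shows "x + \<epsilon> \<in> pos_infinite"
  unfolding pos_infinite_def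
proof (intro CollectI allI)
  fix r :: 'r
  have x0: "0 < x"
    using x scalar_pos[of 1] unfolding pos_infinite_def by (metis less_trans mem_Collect_eq zero_less_one)
  have "scalar (1 + 1) * \<bar>\<epsilon>\<bar> < \<bar>x\<bar>" using \<epsilon> unfolding series_prec_def by (simp del: one_add_one)
  then have "\<bar>\<epsilon>\<bar> + \<bar>\<epsilon>\<bar> < x" by (simp only: scalar_add scalar_1 distrib_right mult_1 abs_of_pos[OF x0])
  moreover have "- (\<epsilon> + \<epsilon>) \<le> \<bar>\<epsilon>\<bar> + \<bar>\<epsilon>\<bar>"
    using add_mono[OF abs_ge_minus_self abs_ge_minus_self, of \<epsilon> \<epsilon>] by simp
  ultimately have "- (\<epsilon> + \<epsilon>) < x" by (rule le_less_trans[rotated])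
  then have "0 < x + (\<epsilon> + \<epsilon>)" using add_strict_right_mono[of "- (\<epsilon> + \<epsilon>)" x "\<epsilon> + \<epsilon>"] by (simp only: left_minus)
  moreover have "scalar (r + r) < x" using x by (simp add: pos_infinite_def)
  ultimately have "scalar r + scalar r < x + (x + (\<epsilon> + \<epsilon>))"
    using add_strict_mono[of "scalar (r + r)" x 0 "x + (\<epsilon> + \<epsilon>)"] by (simp only: scalar_add add_0_right)
  also have "\<dots> = (x + \<epsilon>) + (x + \<epsilon>)" by (simp add: ac_simps)
  finally show "scalar r < x + \<epsilon>" by (meson add_mono not_less)
qed

lemma prec_add_iff:
  fixes x \<epsilon> \<eta> :: "('r::linordered_field, 'n::linordered_ab_group_add, 'k::regular_uncountable) series"
  assumes \<epsilon>: "\<epsilon> \<prec> x"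
  shows "\<eta> \<prec> x + \<epsilon> \<longleftrightarrow> \<eta> \<prec> x"
proof -
  have x: "x \<noteq> 0" "\<forall>n\<ge>dom_monom x. coeff \<epsilon> n = 0" using \<epsilon> by (auto simp: prec_iff)
  then have c: "coeff (x + \<epsilon>) (dom_monom x) \<noteq> 0"
    using dom_monom(1)[of x] by (simp add: plus_series.rep_eq supp_iff)
  then have "dom_monom (x + \<epsilon>) = dom_monom x"
    using x above_dom_monom[of x] by (intro dom_monomI) (auto simp: plus_series.rep_eq)
  moreover have "x + \<epsilon> \<noteq> 0" using c by (auto simp: zero_series.rep_eq)
  ultimately show ?thesis using x(1) by (simp add: prec_iff)
qed

lemma prec_mult_cancel:
  fixes s t u :: "('r::linordered_field, 'n::linordered_ab_group_add, 'k::regular_uncountable) series"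
  assumes "u * s \<prec> u * t" shows "s \<prec> t"
  unfolding series_prec_def
proof (intro allI impI)
  fix r :: 'r assume "0 < r"
  then have "scalar r * \<bar>u * s\<bar> < \<bar>u * t\<bar>" using assms unfolding series_prec_def by simp
  then have "\<bar>u\<bar> * (scalar r * \<bar>s\<bar>) < \<bar>u\<bar> * \<bar>t\<bar>" by (simp add: abs_mult ac_simps)
  then show "scalar r * \<bar>s\<bar> < \<bar>t\<bar>" by (rule mult_left_less_imp_less) simp
qed

lemma supp_power: "supp (s ^ k) \<subseteq> sums_of (supp s)"
  for s :: "('r::linordered_field, 'n::linordered_ab_group_add, 'k::regular_uncountable) series"
proof (induction k)
  case 0
  have "supp (1 :: ('r, 'n, 'k) series) \<subseteq> {0}" by (auto simp: supp_def one_series.rep_eq)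
  moreover have "0 \<in> sums_of (supp s)" unfolding sums_of_def by (auto intro!: exI[of _ "[]"])
  ultimately show ?case by auto
next
  case (Suc k)
  show ?case
  proof
    fix n assume "n \<in> supp (s ^ Suc k)"
    then obtain a b where "n = a + b" "a \<in> supp s" "b \<in> supp (s ^ k)"
      using supp_times[of s "s ^ k"] by auto
    then show "n \<in> sums_of (supp s)" using Suc by (auto intro: sums_of_add sums_of_incl)
  qed
qed

text \<open>The part of a series supported in \<open>A\<close>; truncations are the case of a final segment \<open>A\<close>.\<close>

lift_definition restrict_series :: "'n set \<Rightarrow>
    ('r::linordered_field, 'n::linordered_ab_group_add, 'k::regular_uncountable) series \<Rightarrow> ('r, 'n, 'k) series"
  is "\<lambda>A s m. if m \<in> A then s m else 0"
  by (auto elim!: well_based_subset[rotated] small_subset[rotated])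

section \<open>Fixed points of contracting maps\<close>

text \<open>
  The map \<open>\<Phi>\<close> is contracting in the sense that if \<open>s\<close> and \<open>t\<close> agree above \<open>d\<close>, their images agree also
  at \<open>d\<close>. The last hypothesis replaces completeness: series have small support, so chains of
  truncations need not have a limit. It concerns a coefficient function all of whose truncations
  are series \<open>t\<close>, and are properly continued by \<open>\<Phi> t\<close> at the monomial \<open>w\<close> of truncation.
\<close>

lemma contracting_fixed_point:
  fixes \<Phi> :: "('r::linordered_field, 'n::linordered_ab_group_add, 'k::regular_uncountable) series \<Rightarrow> ('r, 'n, 'k) series"
  assumes maps: "\<And>s. s \<in> series_over A \<Longrightarrow> \<Phi> s \<in> series_over A"
    and contracting: "\<And>s t d n. s \<in> series_over A \<Longrightarrow> t \<in> series_over A \<Longrightarrow>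
      (\<And>m. d < m \<Longrightarrow> coeff s m = coeff t m) \<Longrightarrow> d \<le> n \<Longrightarrow> coeff (\<Phi> s) n = coeff (\<Phi> t) n"
    and small: "\<And>c :: 'n \<Rightarrow> 'r. well_based {w. c w \<noteq> 0} \<Longrightarrow>
      (\<And>w. c w \<noteq> 0 \<Longrightarrow> \<exists>t\<in>series_over A. (\<forall>n. coeff t n = (if w < n then c n else 0)) \<and> coeff (\<Phi> t) w \<noteq> 0) \<Longrightarrow>
      small TYPE('k) {w. c w \<noteq> 0}"
  shows "\<exists>s\<in>series_over A. \<Phi> s = s"
proof -
  \<comment> \<open>The approximations of the fixed point: \<open>\<Phi> s\<close> agrees with \<open>s\<close> from every element of
    \<open>supp s\<close> upwards.\<close>
  define approx where "approx s \<longleftrightarrow> s \<in> series_over A \<and>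
    (\<forall>m\<in>supp s. \<forall>n\<ge>m. coeff (\<Phi> s) n = coeff s n)" for s
  \<comment> \<open>At the first difference \<open>d\<close> the images agree, so one of \<open>s\<close> and \<open>t\<close> differs from its image at
    \<open>d\<close> and has its whole support above \<open>d\<close>.\<close>
  have compatible: "coeff t n = coeff s n"
    if s: "approx s" and t: "approx t" and w: "w \<in> supp s" "w \<le> n" and n: "n \<in> supp t" for s t w n
  proof (rule ccontr)
    assume ne: "coeff t n \<noteq> coeff s n"
    then have st: "s - t \<noteq> 0" by auto
    define d where "d = dom_monom (s - t)"
    have above: "coeff s m = coeff t m" if "d < m" for m
      using above_dom_monom[OF st] that unfolding d_def by (force simp: minus_series.rep_eq)
    have at: "coeff s d \<noteq> coeff t d"
      using dom_monom(1)[OF st] unfolding d_def by (simp add: supp_iff minus_series.rep_eq)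
    have nd: "n \<le> d" using above ne by (metis not_le)
    have "coeff (\<Phi> s) d = coeff (\<Phi> t) d"
      using s t above by (intro contracting[of s t d]) (auto simp: approx_def)
    moreover have "coeff (\<Phi> s) d = coeff s d" using s w nd unfolding approx_def by (meson order_trans)
    moreover have "coeff (\<Phi> t) d = coeff t d" using t n nd unfolding approx_def by blast
    ultimately show False using at by simp
  qed
  \<comment> \<open>The union of all approximations.\<close>
  define c where "c n = (if \<exists>s. approx s \<and> n \<in> supp s then coeff (SOME s. approx s \<and> n \<in> supp s) n else 0)" for n
  have c_eq: "c n = coeff s n" if s: "approx s" and w: "w \<in> supp s" "w \<le> n" for s w n
  proof (cases "\<exists>s. approx s \<and> n \<in> supp s")
    case True
    then have "approx (SOME s. approx s \<and> n \<in> supp s) \<and> n \<in> supp (SOME s. approx s \<and> n \<in> supp s)"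
      by (rule someI_ex)
    then show ?thesis using compatible[OF s _ w] True unfolding c_def by simp
  next
    case False
    then show ?thesis using s unfolding c_def by (auto simp: supp_iff)
  qed
  have c_supp: "\<exists>s. approx s \<and> n \<in> supp s" if "c n \<noteq> 0" for n
    using that unfolding c_def by metis
  have wb: "well_based {w. c w \<noteq> 0}"
    unfolding well_based_alt
  proof (intro allI impI)
    fix B assume B: "B \<subseteq> {w. c w \<noteq> 0}" "B \<noteq> {}"
    then obtain b where b: "b \<in> B" by auto
    then obtain s where s: "approx s" "b \<in> supp s" using B c_supp by blast
    have "{n\<in>B. b \<le> n} \<subseteq> supp s" using c_eq[OF s] B by (auto simp: supp_iff)
    then obtain m where "m \<in> {n\<in>B. b \<le> n}" "\<forall>n\<in>{n\<in>B. b \<le> n}. n \<le> m"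
      using well_based_supp[of s] b unfolding well_based_alt by (metis (no_types, lifting) empty_iff mem_Collect_eq order_refl)
    then show "\<exists>m\<in>B. \<forall>n\<in>B. n \<le> m" by (metis (no_types, lifting) linear mem_Collect_eq order_trans)
  qed
  have "small TYPE('k) {w. c w \<noteq> 0}"
  proof (rule small[OF wb])
    fix w assume "c w \<noteq> 0"
    then obtain s where s: "approx s" "w \<in> supp s" using c_supp by blast
    define t where "t = restrict_series {w<..} s"
    have t_coeff: "coeff t n = (if w < n then coeff s n else 0)" for n
      unfolding t_def by (simp add: restrict_series.rep_eq)
    have t: "t \<in> series_over A"
      using s(1) unfolding approx_def series_over_def by (auto simp: supp_iff t_coeff split: if_splits)
    have "coeff (\<Phi> t) w = coeff (\<Phi> s) w"
      using s t by (intro contracting[of t s w]) (auto simp: approx_def t_coeff)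
    also have "\<dots> = coeff s w" using s unfolding approx_def by blast
    finally have "coeff (\<Phi> t) w \<noteq> 0" using s(2) by (simp add: supp_iff)
    moreover have "coeff t n = (if w < n then c n else 0)" for n
      using c_eq[OF s, of n] by (auto simp: t_coeff)
    ultimately show "\<exists>t\<in>series_over A. (\<forall>n. coeff t n = (if w < n then c n else 0)) \<and> coeff (\<Phi> t) w \<noteq> 0"
      using t by blast
  qed
  then have "\<exists>e :: ('r, 'n, 'k) series. coeff e = c" using wb by (metis (mono_tags, lifting) Series_inverse mem_Collect_eq)
  then obtain e :: "('r, 'n, 'k) series" where e: "coeff e = c" by blast
  have eA: "e \<in> series_over A"
  proof -
    have "n \<in> A" if "c n \<noteq> 0" for n using c_supp[OF that] unfolding approx_def series_over_def by blast
    then show ?thesis by (auto simp: series_over_def supp_iff e)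
  qed
  have fix_above: "coeff (\<Phi> e) n = coeff e n" if m: "m \<in> supp e" "m \<le> n" for m n
  proof -
    obtain s where s: "approx s" "m \<in> supp s" using c_supp[of m] m by (auto simp: supp_iff e)
    have "coeff (\<Phi> e) n = coeff (\<Phi> s) n"
      using s eA m(2) c_eq[OF s] by (intro contracting[of e s m]) (auto simp: approx_def e)
    also have "\<dots> = coeff s n" using s m(2) unfolding approx_def by blast
    finally show ?thesis using c_eq[OF s m(2)] by (simp add: e)
  qed
  have "\<Phi> e = e"
  proof (rule ccontr)
    assume "\<Phi> e \<noteq> e"
    then have ne: "\<Phi> e - e \<noteq> 0" by simp
    define d where "d = dom_monom (\<Phi> e - e)"
    have above: "coeff (\<Phi> e) m = coeff e m" if "d < m" for m
      using above_dom_monom[OF ne] that unfolding d_def by (force simp: minus_series.rep_eq)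
    have at: "coeff (\<Phi> e) d \<noteq> coeff e d"
      using dom_monom(1)[OF ne] unfolding d_def by (simp add: supp_iff minus_series.rep_eq)
    \<comment> \<open>Continuing \<open>e\<close> by the first differing term of \<open>\<Phi> e\<close> yields a longer approximation.\<close>
    define t where "t = restrict_series {d..} (\<Phi> e)"
    have t_coeff: "coeff t n = (if d \<le> n then coeff (\<Phi> e) n else 0)" for n
      unfolding t_def by (simp add: restrict_series.rep_eq)
    have tA: "t \<in> series_over A"
      using maps[OF eA] unfolding series_over_def by (auto simp: supp_iff t_coeff split: if_splits)
    have fix_t: "coeff (\<Phi> t) n = coeff t n" if "d \<le> n" for n
    proof -
      have "coeff (\<Phi> t) n = coeff (\<Phi> e) n"
        using that above by (intro contracting[OF tA eA, of d]) (auto simp: t_coeff)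
      then show ?thesis using that by (simp add: t_coeff)
    qed
    have "approx t" unfolding approx_def
      using tA fix_t by (auto simp: supp_iff t_coeff split: if_splits)
    moreover have ed: "coeff e d = 0" using fix_above[of d d] at by (auto simp: supp_iff)
    ultimately have "c d \<noteq> 0" using c_eq[of t d d] at by (auto simp: supp_iff t_coeff)
    then show False using ed by (simp add: e)
  qed
  then show ?thesis using eA by blast
qed

section \<open>Composition with Taylor expansions\<close>

text \<open>The structure needed for right inverses; \<open>cmp f s\<close> is read \<open>f \<circ> s\<close>.\<close>

locale taylor_composition =
  fixes log D :: "('r::linordered_field, 'n::linordered_ab_group_add, 'k::regular_uncountable) series \<Rightarrow> ('r, 'n, 'k) series"
    and cmp :: "('r, 'n, 'k) series \<Rightarrow> ('r, 'n, 'k) series \<Rightarrow> ('r, 'n, 'k) series"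
    and x :: "('r, 'n, 'k) series"
  assumes derivation: "transserial_derivation log D"
    and derivation_identity: "derivation_identity D x"
    and H_field: "H_field D"
    and composition: "transserial_composition log cmp"
    and composition_identity: "composition_identity cmp x"
    and taylor: "taylor_expansions D cmp"
begin

lemma D_add: "D (f + g) = D f + D g" and D_scalar_times: "D (scalar r * f) = scalar r * D f"
  using derivation unfolding transserial_derivation_def strongly_linear_def by blast+

lemma D_0: "D 0 = 0"
  using D_add[of 0 0] by simp

lemma D_iterate_0: "(D ^^ k) f = 0 \<Longrightarrow> (D ^^ Suc k) f = 0"
  by (simp add: D_0)

lemma x_pos_infinite: "x \<in> pos_infinite"
  using composition_identity unfolding composition_identity_def by blast

lemma
  assumes "s \<in> pos_infinite"
  shows cmp_strongly_linear: "strongly_linear (\<lambda>f. cmp f s)"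
    and cmp_1: "cmp 1 s = 1"
    and cmp_strict_mono: "strict_mono (\<lambda>f. cmp f s)"
    and cmp_x: "cmp x s = s"
  using assms composition composition_identity
  unfolding transserial_composition_def composition_identity_def by blast+

lemma
  assumes "s \<in> pos_infinite"
  shows cmp_add: "cmp (f + g) s = cmp f s + cmp g s"
    and cmp_scalar_times: "cmp (scalar r * f) s = scalar r * cmp f s"
  using cmp_strongly_linear[OF assms] unfolding strongly_linear_def by blast+

lemma cmp_0: "s \<in> pos_infinite \<Longrightarrow> cmp 0 s = 0"
  using cmp_add[of s 0 0] by simp

lemma cmp_eq_0_iff: "s \<in> pos_infinite \<Longrightarrow> cmp f s = 0 \<longleftrightarrow> f = 0"
  using strict_mono_eq[OF cmp_strict_mono[of s], of f 0] by (simp add: cmp_0)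

lemma cmp_uminus: "s \<in> pos_infinite \<Longrightarrow> cmp (- f) s = - cmp f s"
  using cmp_add[of s f "- f"] by (simp add: cmp_0 eq_neg_iff_add_eq_0 add.commute)

lemma cmp_abs: "s \<in> pos_infinite \<Longrightarrow> \<bar>cmp f s\<bar> = cmp \<bar>f\<bar> s"
  using strict_mono_less[OF cmp_strict_mono[of s], of f 0]
  by (simp add: abs_series_def cmp_0 cmp_uminus)

lemma cmp_prec:
  assumes s: "s \<in> pos_infinite" and fg: "f \<prec> g"
  shows "cmp f s \<prec> cmp g s"
  unfolding series_prec_def
proof (intro allI impI)
  fix r :: 'r assume "0 < r"
  then have "scalar r * \<bar>f\<bar> < \<bar>g\<bar>" using fg unfolding series_prec_def by simp
  then have "cmp (scalar r * \<bar>f\<bar>) s < cmp \<bar>g\<bar> s" by (rule strict_monoD[OF cmp_strict_mono[OF s]])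
  then show "scalar r * \<bar>cmp f s\<bar> < \<bar>cmp g s\<bar>" by (simp add: s cmp_abs cmp_scalar_times)
qed

text \<open>
  For every scalar \<open>q\<close> the series \<open>x + q f\<close> is positive infinite, so its derivative \<open>1 + q f'\<close> is positive.
\<close>

lemma deriv_prec_1:
  assumes f: "f \<prec> x" shows "D f \<prec> 1"
  unfolding series_prec_def
proof (intro allI impI)
  fix r :: 'r assume "0 < r"
  have *: "0 < 1 + scalar q * D f" for q
  proof -
    have "scalar q * f \<prec> x" using f by (simp add: prec_iff coeff_scalar_times)
    then have "x + scalar q * f \<in> pos_infinite" by (rule pos_infinite_add[OF x_pos_infinite])
    then have "0 < D (x + scalar q * f)" using H_field unfolding H_field_def by blast
    then show ?thesis
      using derivation_identity by (simp add: D_add D_scalar_times derivation_identity_def)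
  qed
  have "scalar r * D f < 1" using *[of "- r"] by (simp add: scalar_uminus)
  moreover have "- (scalar r * D f) < 1"
    using add_strict_right_mono[OF *[of r], of "- (scalar r * D f)"] by (simp add: add.assoc)
  ultimately have "\<bar>scalar r * D f\<bar> < 1" by (rule abs_less_iff[THEN iffD2, OF conjI])
  then show "scalar r * \<bar>D f\<bar> < \<bar>1\<bar>" by (simp only: abs_mult abs_of_pos[OF scalar_pos[OF \<open>0 < r\<close>]] abs_one)
qed

text \<open>Strong linearity, applied to the family of the terms of \<open>f\<close>.\<close>

lemma coeff_cmp:
  assumes s: "s \<in> pos_infinite"
  shows "coeff (cmp f s) n =
    (\<Sum>m | m \<in> supp f \<and> n \<in> supp (cmp (monom m) s). coeff f m * coeff (cmp (monom m) s) n)"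
proof -
  \<comment> \<open>Strong linearity is about families indexed by pairs; the second component is a dummy.\<close>
  let ?I = "supp f \<times> {0::nat}"
  define g :: "'n \<times> nat \<Rightarrow> ('r, 'n, 'k) series" where "g i = scalar (coeff f (fst i)) * monom (fst i)" for i
  have g_coeff: "coeff (g i) m = (if m = fst i then coeff f m else 0)" for i m
    by (simp add: g_def coeff_scalar_times monom.rep_eq)
  have g_supp: "{i \<in> ?I. m \<in> supp (g i)} = (if m \<in> supp f then {(m, 0)} else {})" for m
    by (auto simp: supp_iff g_coeff)
  have "(\<Union>i\<in>?I. supp (g i)) = supp f" by (auto simp: supp_iff g_coeff split: if_splits)
  then have "has_family_sum g ?I f"
    unfolding has_family_sum_def summable_family_def g_supp
    by (auto simp: well_based_supp small_supp g_coeff supp_iff)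
  then have sum: "has_family_sum (\<lambda>i. cmp (g i) s) ?I (cmp f s)"
    using cmp_strongly_linear[OF s] unfolding strongly_linear_def by blast
  have cg: "cmp (g i) s = scalar (coeff f (fst i)) * cmp (monom (fst i)) s" for i
    by (simp add: g_def cmp_scalar_times[OF s])
  have "coeff (cmp f s) n = (\<Sum>i | i \<in> ?I \<and> n \<in> supp (cmp (g i) s). coeff (cmp (g i) s) n)"
    using sum unfolding has_family_sum_def by blast
  also have "\<dots> = (\<Sum>m | m \<in> supp f \<and> n \<in> supp (cmp (monom m) s). coeff f m * coeff (cmp (monom m) s) n)"
    by (rule sum.reindex_bij_witness[of _ "\<lambda>m. (m, 0)" fst]) (auto simp: cg coeff_scalar_times supp_iff)
  finally show ?thesis .
qed

lemma supp_cmp: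
  assumes "s \<in> pos_infinite" "n \<in> supp (cmp f s)"
  shows "\<exists>m\<in>supp f. n \<in> supp (cmp (monom m) s)"
proof -
  have "coeff (cmp f s) n \<noteq> 0" using assms(2) by (simp add: supp_iff)
  then have "(\<Sum>m | m \<in> supp f \<and> n \<in> supp (cmp (monom m) s). coeff f m * coeff (cmp (monom m) s) n) \<noteq> 0"
    by (simp only: coeff_cmp[OF assms(1), symmetric] not_False_eq_True)
  then show ?thesis
    by (auto elim!: sum.not_neutral_contains_not_neutral)
qed

lemma taylor_configuration_monom:
  assumes "s \<in> pos_infinite" "\<eta> \<prec> s" "cmp (D (monom m)) s * \<eta> \<prec> cmp (monom m) s"
  shows "taylor_configuration D cmp (monom m) s \<eta>"
  using assms unfolding taylor_configuration_def
  by (auto simp: supp_iff monom.rep_eq split: if_splits)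

text \<open>
  The terms of order at least one of the Taylor expansion are \<open>\<prec> \<eta>\<close>, because the first of them is
  \<open>(m' \<circ> s) \<eta>\<close> with \<open>m' \<circ> s \<prec> 1\<close> and they decrease as long as they do not vanish.
\<close>

lemma taylor_difference_prec:
  assumes m: "monom m \<prec> x" and s: "s \<in> pos_infinite" and \<eta>: "\<eta> \<prec> s" "\<eta> \<noteq> 0"
    and conf: "cmp (D (monom m)) s * \<eta> \<prec> cmp (monom m) s"
  shows "cmp (monom m) (s + \<eta>) - cmp (monom m) s \<prec> \<eta>"
proof -
  define T where "T k = cmp ((D ^^ k) (monom m)) s * \<eta> ^ k" for k
  have tc: "taylor_configuration D cmp (monom m) s \<eta>"
    by (rule taylor_configuration_monom[OF s \<eta>(1) conf])
  have "has_family_sum (\<lambda>k. scalar (1 / fact k) * cmp ((D ^^ k) (monom m)) s * \<eta> ^ k) UNIV (cmp (monom m) (s + \<eta>))"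
    and decr: "\<And>k. T k \<noteq> 0 \<Longrightarrow> T (Suc k) \<prec> T k"
    using taylor tc unfolding taylor_expansions_def T_def Suc_eq_plus1 by blast+
  then have sum: "has_family_sum (\<lambda>k. scalar (1 / fact k) * T k) UNIV (cmp (monom m) (s + \<eta>))"
    by (simp add: T_def mult.assoc)
  have T: "T (Suc k) \<prec> \<eta>" for k
  proof (induction k)
    case 0
    show ?case
      unfolding T_def using cmp_prec[OF s deriv_prec_1[OF m]] \<eta>(2)
      by (simp add: cmp_1[OF s] prec_1_mult)
  next
    case (Suc k)
    show ?case
    proof (cases "T (Suc k) = 0")
      case True
      then have "(D ^^ Suc k) (monom m) = 0" using \<eta>(2) by (simp add: T_def cmp_eq_0_iff[OF s])
      then have "T (Suc (Suc k)) = 0" using D_iterate_0[of "Suc k"] by (simp add: T_def cmp_0[OF s])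
      then show ?thesis using \<eta>(2) by (simp add: prec_0)
    next
      case False
      then show ?thesis using decr Suc prec_trans by blast
    qed
  qed
  have "coeff (cmp (monom m) (s + \<eta>)) n = coeff (cmp (monom m) s) n" if n: "dom_monom \<eta> \<le> n" for n
  proof -
    have "k = 0" if "coeff (T k) n \<noteq> 0" for k
      using T[of "k - 1"] n that by (cases k) (auto simp: prec_iff)
    then have "{k. k \<in> UNIV \<and> n \<in> supp (scalar (1 / fact k) * T k)} = (if coeff (T 0) n = 0 then {} else {0})"
      by (auto simp: supp_iff coeff_scalar_times)
    then have "coeff (cmp (monom m) (s + \<eta>)) n = coeff (T 0) n"
      using sum unfolding has_family_sum_def by (simp add: coeff_scalar_times)
    then show ?thesis by (simp add: T_def)
  qed
  then show ?thesis using \<eta>(2) by (simp add: prec_iff minus_series.rep_eq)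
qed

lemma prec_if_not_taylor:
  assumes m: "monom m \<prec> x" and s: "s \<in> pos_infinite" and \<eta>: "\<eta> \<noteq> 0"
    and conf: "\<not> cmp (D (monom m)) s * \<eta> \<prec> cmp (monom m) s"
  shows "cmp (monom m) s \<prec> \<eta>"
proof -
  have "cmp (D (monom m)) s \<prec> 1" using cmp_prec[OF s deriv_prec_1[OF m]] by (simp add: cmp_1[OF s])
  then show ?thesis using not_prec_prec_trans[OF conf] prec_1_mult[OF _ \<eta>] by blast
qed

text \<open>
  The Taylor configuration may hold at neither, one or both of \<open>(s, \<eta>)\<close> and \<open>(s + \<eta>, -\<eta>)\<close>; where it
  fails, the value of the monomial is itself \<open>\<prec> \<eta>\<close>.
\<close>

lemma monom_difference_prec:
  assumes m: "monom m \<prec> x" and s: "s \<in> pos_infinite" "s + \<eta> \<in> pos_infinite"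
    and \<eta>: "\<eta> \<prec> s" "\<eta> \<prec> s + \<eta>" "\<eta> \<noteq> 0"
  shows "cmp (monom m) (s + \<eta>) - cmp (monom m) s \<prec> \<eta>"
proof (cases "cmp (D (monom m)) s * \<eta> \<prec> cmp (monom m) s")
  case True
  then show ?thesis by (rule taylor_difference_prec[OF m s(1) \<eta>(1,3)])
next
  case False
  then have 1: "cmp (monom m) s \<prec> \<eta>" by (rule prec_if_not_taylor[OF m s(1) \<eta>(3)])
  show ?thesis
  proof (cases "cmp (D (monom m)) (s + \<eta>) * (- \<eta>) \<prec> cmp (monom m) (s + \<eta>)")
    case True
    then have "cmp (monom m) (s + \<eta> + - \<eta>) - cmp (monom m) (s + \<eta>) \<prec> - \<eta>"
      by (intro taylor_difference_prec[OF m s(2)]) (use \<eta> in \<open>auto simp: prec_uminus\<close>)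
    then show ?thesis using prec_uminus(1)[of "cmp (monom m) s - cmp (monom m) (s + \<eta>)" \<eta>]
      by (simp add: prec_uminus)
  next
    case False
    then have "cmp (monom m) (s + \<eta>) \<prec> - \<eta>"
      by (intro prec_if_not_taylor[OF m s(2)]) (use \<eta>(3) in auto)
    then show ?thesis using 1 by (simp add: prec_uminus prec_diff)
  qed
qed

lemma monom_prec_if_supp:
  assumes "f \<prec> g" "m \<in> supp f" shows "monom m \<prec> g"
  using assms by (auto simp: prec_iff supp_iff monom.rep_eq)

lemma difference_prec:
  assumes f: "f \<prec> x" and s: "s \<in> pos_infinite" "s + \<eta> \<in> pos_infinite"
    and \<eta>: "\<eta> \<prec> s" "\<eta> \<prec> s + \<eta>" "\<eta> \<noteq> 0"
  shows "cmp f (s + \<eta>) - cmp f s \<prec> \<eta>"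
proof -
  have "coeff (cmp f (s + \<eta>)) n = coeff (cmp f s) n" if n: "dom_monom \<eta> \<le> n" for n
  proof -
    have eq: "coeff (cmp (monom m) (s + \<eta>)) n = coeff (cmp (monom m) s) n" if "m \<in> supp f" for m
      using monom_difference_prec[OF monom_prec_if_supp[OF f that] s \<eta>] n
      unfolding prec_iff by (simp add: minus_series.rep_eq)
    show ?thesis
      by (rule trans[OF coeff_cmp[OF s(2)] trans[OF sum.cong coeff_cmp[OF s(1), symmetric]]])
        (use eq in \<open>auto simp: supp_iff\<close>)
  qed
  then show ?thesis using \<eta>(3) by (simp add: prec_iff minus_series.rep_eq)
qed

text \<open>
  A right inverse of \<open>x + \<delta>\<close> is \<open>x + \<epsilon>\<close> with \<open>\<epsilon> = - \<delta> \<circ> (x + \<epsilon>)\<close>. The series \<open>\<epsilon> \<prec> x\<close> over \<open>M\<close> are the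
  series over the set \<open>A\<close> of the elements of \<open>M\<close> below \<open>x\<close>.
\<close>

lemma right_inverse:
  fixes M :: "'n set"
  assumes x: "x = monom x\<^sub>0" and \<delta>: "\<delta> \<prec> x"
    and closed: "\<And>\<epsilon>. \<epsilon> \<in> series_over M \<Longrightarrow> \<epsilon> \<prec> x \<Longrightarrow> cmp \<delta> (x + \<epsilon>) \<in> series_over M"
  shows "\<exists>\<epsilon>\<in>series_over M. \<epsilon> \<prec> x \<and> cmp (x + \<delta>) (x + \<epsilon>) = x"
proof -
  define A where "A = {n \<in> M. n < x\<^sub>0}"
  define \<Phi> where "\<Phi> \<epsilon> = - cmp \<delta> (x + \<epsilon>)" for \<epsilon>
  have A: "\<epsilon> \<in> series_over A \<longleftrightarrow> \<epsilon> \<in> series_over M \<and> \<epsilon> \<prec> x" for \<epsilon> :: "('r, 'n, 'k) series"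
    unfolding A_def series_over_def x prec_monom_iff by auto
  have inf: "x + \<epsilon> \<in> pos_infinite" if "\<epsilon> \<in> series_over A" for \<epsilon>
    using that A pos_infinite_add[OF x_pos_infinite] by blast
  have "\<exists>\<epsilon>\<in>series_over A. \<Phi> \<epsilon> = \<epsilon>"
  proof (rule contracting_fixed_point)
    fix \<epsilon> :: "('r, 'n, 'k) series" assume \<epsilon>: "\<epsilon> \<in> series_over A"
    have "cmp \<delta> (x + \<epsilon>) \<prec> x + \<epsilon>" using cmp_prec[OF inf[OF \<epsilon>] \<delta>] by (simp add: cmp_x inf \<epsilon>)
    then have "\<Phi> \<epsilon> \<prec> x" using \<epsilon> by (simp add: A prec_add_iff \<Phi>_def prec_uminus)
    moreover have "supp (\<Phi> \<epsilon>) = supp (cmp \<delta> (x + \<epsilon>))" by (simp add: \<Phi>_def supp_def uminus_series.rep_eq)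
    ultimately show "\<Phi> \<epsilon> \<in> series_over A"
      using closed[of \<epsilon>] \<epsilon> unfolding A by (simp add: series_over_def)
  next
    fix s t :: "('r, 'n, 'k) series" and d n
    assume s: "s \<in> series_over A" and t: "t \<in> series_over A"
      and above: "\<And>m. d < m \<Longrightarrow> coeff s m = coeff t m" and n: "d \<le> n"
    show "coeff (\<Phi> s) n = coeff (\<Phi> t) n"
    proof (cases "s = t")
      case False
      define \<eta> where "\<eta> = t - s"
      have \<eta>: "\<eta> \<noteq> 0" using False by (simp add: \<eta>_def)
      have "dom_monom \<eta> \<le> d"
        using dom_monom(1)[OF \<eta>] above by (force simp: \<eta>_def supp_iff minus_series.rep_eq not_less[symmetric])
      have st: "x + s + \<eta> = x + t" by (simp add: \<eta>_def)
      have "\<eta> \<prec> x" unfolding \<eta>_def using s t A prec_diff by blast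
      then have "\<eta> \<prec> x + s" "\<eta> \<prec> x + t" using s t A prec_add_iff by blast+
      then have "cmp \<delta> (x + t) - cmp \<delta> (x + s) \<prec> \<eta>"
        using difference_prec[OF \<delta> inf[OF s], of \<eta>] inf[OF t] \<eta> unfolding st by blast
      then show ?thesis using \<open>dom_monom \<eta> \<le> d\<close> n
        by (auto simp: prec_iff minus_series.rep_eq uminus_series.rep_eq \<Phi>_def)
    qed simp
  next
    fix c :: "'n \<Rightarrow> 'r"
    assume wb: "well_based {w. c w \<noteq> 0}"
      and ex: "\<And>w. c w \<noteq> 0 \<Longrightarrow> \<exists>t\<in>series_over A.
        (\<forall>n. coeff t n = (if w < n then c n else 0)) \<and> coeff (\<Phi> t) w \<noteq> 0"
    have "\<exists>t. \<forall>w. c w \<noteq> 0 \<longrightarrow> t w \<in> series_over A \<and>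
        (\<forall>n. coeff (t w) n = (if w < n then c n else 0)) \<and> coeff (\<Phi> (t w)) w \<noteq> 0"
      by (rule choice) (use ex in blast)
    then obtain t where t: "\<And>w. c w \<noteq> 0 \<Longrightarrow> t w \<in> series_over A"
      and t_coeff: "\<And>w n. c w \<noteq> 0 \<Longrightarrow> coeff (t w) n = (if w < n then c n else 0)"
      and \<Phi>t: "\<And>w. c w \<noteq> 0 \<Longrightarrow> coeff (\<Phi> (t w)) w \<noteq> 0"
      by blast
    \<comment> \<open>\<open>m\<close> is in Taylor configuration at \<open>x + t w\<close> for increments of the size of \<open>w\<close>, that is, for
      all increments that come from continuing \<open>t w\<close>.\<close>
    define good where "good m w \<longleftrightarrow> c w \<noteq> 0 \<and>
      cmp (D (monom m)) (x + t w) * monom w \<prec> cmp (monom m) (x + t w)" for m w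
    define p where "p m = (SOME w. good m w)" for m
    define B where "B = (\<Union>m\<in>supp \<delta>. insert (p m) (supp (t (p m))) \<union>
      (\<Union>k\<in>UNIV. supp (cmp ((D ^^ k) (monom m)) (x + t (p m)))))"
    have smallB: "small TYPE('k) B"
      unfolding B_def by (intro small_UN small_Un small_insert small_supp small_nat)
    have step: "w \<in> sums_of B" if w: "c w \<noteq> 0" and above: "\<And>v. c v \<noteq> 0 \<Longrightarrow> w < v \<Longrightarrow> v \<in> sums_of B" for w
    proof -
      have infw: "x + t w \<in> pos_infinite" using inf t w by blast
      have "w \<in> supp (cmp \<delta> (x + t w))" using \<Phi>t[OF w] by (simp add: \<Phi>_def supp_iff uminus_series.rep_eq)
      then obtain m where m: "m \<in> supp \<delta>" and wm: "w \<in> supp (cmp (monom m) (x + t w))"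
        using supp_cmp[OF infw] by blast
      have mx: "monom m \<prec> x" using monom_prec_if_supp[OF \<delta> m] .
      have "\<not> cmp (monom m) (x + t w) \<prec> monom w" using wm by (auto simp: prec_monom_iff)
      then have "good m w" using prec_if_not_taylor[OF mx infw monom_neq_0] w unfolding good_def by blast
      then have "good m (p m)" unfolding p_def by (rule someI)
      then have p: "c (p m) \<noteq> 0"
        and conf: "cmp (D (monom m)) (x + t (p m)) * monom (p m) \<prec> cmp (monom m) (x + t (p m))"
        unfolding good_def by auto
      show ?thesis
      proof (cases "p m \<le> w")
        case True
        then have "w \<in> insert (p m) (supp (t (p m)))" using w t_coeff[OF p, of w] by (auto simp: supp_iff)
        then show ?thesis using m by (auto simp: B_def intro!: sums_of_incl)
      next
        case False
        define s where "s = x + t (p m)"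
        define \<eta> where "\<eta> = t w - t (p m)"
        have s: "s \<in> pos_infinite" using inf t p unfolding s_def by blast
        have \<eta>_coeff: "coeff \<eta> n = (if w < n \<and> n \<le> p m then c n else 0)" for n
          using False by (auto simp: \<eta>_def minus_series.rep_eq t_coeff w p)
        \<comment> \<open>As \<open>\<eta>\<close> has the size of \<open>p m\<close>, the Taylor configuration for \<open>p m\<close> passes to \<open>\<eta>\<close>.\<close>
        have "dom_monom \<eta> = p m" by (rule dom_monomI) (use False p in \<open>auto simp: \<eta>_coeff\<close>)
        then have "\<not> monom (p m) \<prec> \<eta>" by (auto simp: prec_iff monom.rep_eq)
        then have "\<not> cmp (D (monom m)) s * monom (p m) \<prec> cmp (D (monom m)) s * \<eta>"
          using prec_mult_cancel by blast
        then have "cmp (D (monom m)) s * \<eta> \<prec> cmp (monom m) s"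
          using conf unfolding s_def[symmetric] by (rule not_prec_prec_trans)
        moreover have "\<eta> \<prec> s"
          using t[OF w] t[OF p] unfolding s_def \<eta>_def by (simp add: A prec_add_iff prec_diff)
        ultimately have "taylor_configuration D cmp (monom m) s \<eta>"
          by (intro taylor_configuration_monom s)
        then have sum: "has_family_sum (\<lambda>k. scalar (1 / fact k) * cmp ((D ^^ k) (monom m)) s * \<eta> ^ k) UNIV
            (cmp (monom m) (s + \<eta>))"
          using taylor unfolding taylor_expansions_def by blast
        have "coeff (cmp (monom m) (s + \<eta>)) w \<noteq> 0" using wm by (simp add: s_def \<eta>_def supp_iff)
        then obtain k where "coeff (scalar (1 / fact k) * cmp ((D ^^ k) (monom m)) s * \<eta> ^ k) w \<noteq> 0"
          using sum unfolding has_family_sum_def by (auto elim!: sum.not_neutral_contains_not_neutral)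
        then have "w \<in> supp (cmp ((D ^^ k) (monom m)) s * \<eta> ^ k)"
          by (simp add: mult.assoc coeff_scalar_times supp_iff)
        then obtain a b where ab: "w = a + b" "a \<in> supp (cmp ((D ^^ k) (monom m)) s)" "b \<in> supp (\<eta> ^ k)"
          using supp_times by fastforce
        have "a \<in> B" using ab(2) m unfolding B_def s_def by blast
        moreover have "supp \<eta> \<subseteq> sums_of B" using above by (auto simp: supp_iff \<eta>_coeff split: if_splits)
        then have "b \<in> sums_of B" using ab(3) supp_power sums_of_sums by blast
        ultimately show ?thesis unfolding ab(1) by (blast intro: sums_of_add sums_of_incl)
      qed
    qed
    have "{w. c w \<noteq> 0} \<subseteq> sums_of B"
    proof (rule ccontr)
      assume "\<not> {w. c w \<noteq> 0} \<subseteq> sums_of B"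
      then have "{w. c w \<noteq> 0} - sums_of B \<noteq> {}" by blast
      then obtain w where w: "w \<in> {w. c w \<noteq> 0} - sums_of B"
        and max: "\<forall>v\<in>{w. c w \<noteq> 0} - sums_of B. v \<le> w"
        using wb[unfolded well_based_alt, rule_format, OF Diff_subset] by blast
      have "v \<in> sums_of B" if "c v \<noteq> 0" "w < v" for v using max that leD by blast
      then show False using step w by blast
    qed
    then show "small TYPE('k) {w. c w \<noteq> 0}" by (rule small_subset) (rule small_sums_of[OF smallB])
  qed
  then obtain \<epsilon> where \<epsilon>: "\<epsilon> \<in> series_over A" "- cmp \<delta> (x + \<epsilon>) = \<epsilon>" unfolding \<Phi>_def by blast
  have "cmp (x + \<delta>) (x + \<epsilon>) = x + \<epsilon> + cmp \<delta> (x + \<epsilon>)"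
    using inf[OF \<epsilon>(1)] by (simp add: cmp_add cmp_x)
  also have "\<dots> = x" using \<epsilon>(2)[symmetric] by (metis add.assoc add.left_inverse add_0_right)
  finally show ?thesis using \<epsilon>(1) A by blast
qed

end

theorem theorem3p1:
  fixes log D :: "('r::linordered_field, 'n::linordered_ab_group_add, 'k::regular_uncountable) series \<Rightarrow> ('r, 'n, 'k) series"
    and cmp :: "('r, 'n, 'k) series \<Rightarrow> ('r, 'n, 'k) series \<Rightarrow> ('r, 'n, 'k) series"
    and x :: "('r, 'n, 'k) series"
    and M :: "'n set"
  assumes "(UNIV :: 'n set) \<noteq> {0}"
    and "transserial_field log"
    and "exponentially_closed log"
    and "transserial_derivation log D"
    and "derivation_identity D x"
    and "H_field D"
    and "flat_derivation log D x"
    and "transserial_composition log cmp"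
    and "composition_identity cmp x"
    and "flat_composition log cmp"
    and "chain_rule D cmp"
    and "taylor_expansions D cmp"
    and "subgroup M monomial_group"
    and "x \<in> monom ` M"
    and "D ` series_over M \<subseteq> series_over M"
    and "\<forall>m\<in>M. \<forall>\<delta>\<in>series_over M. \<delta> \<prec> x \<longrightarrow> cmp (monom m) (x + \<delta>) \<in> series_over M"
  shows "group \<lparr>carrier = tangent_series x M, monoid.mult = cmp, one = x\<rparr>"
proof -
  note hyps = assms
  interpret taylor_composition log D cmp x
    by unfold_locales (fact hyps)+
  obtain x\<^sub>0 where x\<^sub>0: "x = monom x\<^sub>0" using \<open>x \<in> monom ` M\<close> by blast
  have closed: "cmp f (x + \<delta>) \<in> series_over M"
    if "f \<in> series_over M" "\<delta> \<in> series_over M" "\<delta> \<prec> x" for f \<delta>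
  proof -
    have "x + \<delta> \<in> pos_infinite" using pos_infinite_add[OF x_pos_infinite that(3)] .
    then show ?thesis
      using supp_cmp[of "x + \<delta>" _ f] that hyps(16) unfolding series_over_def by blast
  qed
  let ?G = "tangent_series x M"
  have inf: "s \<in> pos_infinite" if "s \<in> ?G" for s
    using that pos_infinite_add[OF x_pos_infinite] unfolding tangent_series_def by blast
  have assoc: "cmp (cmp f s) t = cmp f (cmp s t)" if "s \<in> ?G" "t \<in> ?G" for f s t
    using hyps(8) inf that unfolding transserial_composition_def by simp
  have ident: "cmp f x = f" for f
    using hyps(9) unfolding composition_identity_def by blast
  have right: "\<exists>t\<in>?G. cmp s t = x" if "s \<in> ?G" for s
    using that right_inverse[OF x\<^sub>0] closed unfolding tangent_series_def by blast
  show ?thesis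
  proof (rule groupI, unfold partial_object.simps monoid.simps)
    fix s t assume s: "s \<in> ?G" and t: "t \<in> ?G"
    obtain \<epsilon> where \<epsilon>: "s = x + \<epsilon>" "\<epsilon> \<in> series_over M" "\<epsilon> \<prec> x" using s unfolding tangent_series_def by blast
    obtain \<delta> where \<delta>: "t = x + \<delta>" "\<delta> \<in> series_over M" "\<delta> \<prec> x" using t unfolding tangent_series_def by blast
    have "cmp s t = x + (\<delta> + cmp \<epsilon> t)" using inf[OF t] by (simp add: \<epsilon>(1) cmp_add cmp_x) (simp add: \<delta>(1) add.assoc)
    moreover have "\<delta> + cmp \<epsilon> t \<in> series_over M"
      using closed[OF \<epsilon>(2) \<delta>(2,3)] \<delta>(2) supp_plus[of \<delta>] unfolding \<delta>(1) series_over_def by blast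
    moreover have "cmp \<epsilon> t \<prec> x"
      using cmp_prec[OF inf[OF t] \<epsilon>(3)] \<delta>(3) unfolding cmp_x[OF inf[OF t]] by (simp add: \<delta>(1) prec_add_iff)
    then have "\<delta> + cmp \<epsilon> t \<prec> x" using \<delta>(3) by (simp add: prec_add)
    ultimately show "cmp s t \<in> ?G" unfolding tangent_series_def by blast
  next
    show "x \<in> ?G" unfolding tangent_series_def
      by (auto intro!: exI[of _ 0] simp: series_over_def supp_def zero_series.rep_eq prec_0 x\<^sub>0 monom_neq_0)
  next
    fix s assume s: "s \<in> ?G"
    show "cmp x s = s" using cmp_x inf s by blast
    \<comment> \<open>A right inverse \<open>t\<close> is a left inverse, since \<open>s\<close> is equal to the right inverse \<open>u\<close> of \<open>t\<close>.\<close>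
    obtain t where t: "t \<in> ?G" "cmp s t = x" using right s by blast
    obtain u where u: "u \<in> ?G" "cmp t u = x" using right t by blast
    have "s = cmp (cmp s t) u" using assoc[OF t(1) u(1)] u(2) ident by simp
    also have "\<dots> = u" using t(2) cmp_x inf u(1) by simp
    finally show "\<exists>t\<in>?G. cmp t s = x" using t u by blast
  qed (use assoc in auto)
qed

end
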